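(* Let $m\ge2$ be an integer and let $\Psi_i=(\gamma_{i1},\gamma_{i2},\dots)$, $0\le i\le m-1$, be infinite positive vectors with $\sum_{j\ge1}\gamma_{ij}<\infty$ for each $i$ and $\sup_{i,j}\gamma_{ij}<1$. Let $H_m:\mathcal Q_m\to[0,\infty)$, $H_m(x)=\dim_{\mathrm H}(E(x;m))$, be the dimension function of the associated infinitely generated non-stationary Moran fractals $E(x;m)\subset\mathbb R^d$. Then $H_m$ is measurable, is everywhere discontinuous on $\mathcal Q_m$, and is constant on every set of positive dimension $F(p_0,\dots,p_{m-1})$. Moreover, for any $x\in\mathcal Q_m$ and any neighbourhood $U$ of $x$, $H_m$ attains all its possible values inside $U$, i.e. $$H_m(\mathcal Q_m)=H_m(U\cap\mathcal Q_m).$$ The same conclusions hold for the function $H_\beta:\mathcal Q_\beta\to[0,\infty)$, $H_\beta(x)=\dim_{\mathrm H}(E(x;\beta))$, associated to $\beta>1$, $\beta\notin\mathbb Z$, and to a fixed collection of infinite positive vectors $\Psi_i=(\gamma_{i1},\gamma_{i2},\dots)$, $0\le i\le[\beta]$, with $\sum_{j\ge1}\gamma_{ij}<\infty$ for each $i$ and $\sup_{i,j}\gamma_{ij}<1$ (with $\mathcal Q_m$ and $F(p_0,\dots,p_{m-1})$ replaced by $\mathcal Q_\beta$ and $F(p_0,\dots,p_{[\beta]})$).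
   Context: $[y]$ and $\{y\}=y-[y]$ are the integer and fractional parts of $y$; $\mathbb N=\{1,2,\dots\}$; $|B|$ is the diameter of $B\subset\mathbb R^d$; $\dim_{\mathrm H}$ is Hausdorff dimension. Expansions. Let $b=m$ (an integer $\ge2$) or $b=\beta$ (with $\beta>1$, $\beta\notin\mathbb Z$), $T_b:[0,1)\to[0,1)$, $T_b(x)=bx\bmod1$, and $d_k(x)=[b\,T_b^{k-1}(x)]$, $k\ge1$, so $x=\sum_{k\ge1}d_k(x)b^{-k}$. The digits lie in $I=\{0,\dots,m-1\}$, respectively $I=\{0,\dots,[\beta]\}$. A stochastic vector is $p=(p_i)_{i\in I}$ with all $p_i>0$ and $\sum_ip_i=1$. $F(p)$ (written $F(p_0,\dots,p_{m-1})$, resp. $F(p_0,\dots,p_{[\beta]})$) is the set of $x\in[0,1)$ with $\lim_{n\to\infty}\frac1n\mathrm{Card}\{1\le j\le n:d_j(x)=i\}=p_i$ for all $i\in I$. $\mathcal Q_m$ (resp. $\mathcal Q_\beta$), the set of quasinormal numbers, is the union of all $F(p)$ over stochastic vectors $p$. Moran fractals. For $x\in F(p)$ put $c_{kj}:=\gamma_{d_k(x)\,j}$, $k,j\ge1$. Let $D_0=\{\emptyset\}$ (empty word), $D_k=\mathbb N^k$, $D=\bigcup_{k\ge0}D_k$, $D_\infty=\mathbb N^{\mathbb N}$; $\sigma|_k$ is truncation to length $k$; $\sigma*j$ is $\sigma$ followed by $j$. $J\subset\mathbb R^d$ is a fixed nonempty compact set with $J=\mathrm{cl}(\mathrm{int}\,J)$,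 $|J|=1$. Take a collection $\{J_\sigma:\sigma\in D\}$ with: (1) $J_\emptyset=J$; (2) each $J_\sigma$ is the image of $J$ under a similarity of $\mathbb R^d$; (3) for $\sigma\in D$, the sets $J_{\sigma*1},J_{\sigma*2},\dots$ are subsets of $J_\sigma$ with pairwise disjoint interiors; (4) $|J_{\sigma*j}|/|J_\sigma|=c_{kj}$ for $k\ge1$, $\sigma\in D_{k-1}$, $j\ge1$ (it is understood that such collections exist). The Moran fractal is $\bigcup_{\sigma\in D_\infty}\bigcap_{i\ge1}J_{\sigma|_i}$, denoted $E(x;m)$, resp. $E(x;\beta)$. Let $\theta=\max_{i\in I}\inf\{t>0:\sum_j\gamma_{ij}^t<\infty\}$ and $P(t)=\sum_{i\in I}p_i\log\sum_{j\ge1}\gamma_{ij}^t$ for $t>\theta$. Standing assumptions: $\sum_j\gamma_{ij}^\theta=\infty$ for some $i\in I$, and $0<P(u)<\infty$ for some $u\in(\theta,\infty)$. The dimension of the fractal depends only on $p$ and the $\Psi_i$ (it is the unique zero of $P$, a result of the paper), so $H_m,H_\beta$ are well defined.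
   Formalization: Everywhere discontinuity is asserted only when no single t>θ satisfies Σ_j γ_ij^t=1 for all digits i; in that excluded case (e.g. all Ψ_i equal) the dimension function is constant, so the claim as stated fails. *)

theory Defs
  imports "HOL-Analysis.Analysis"
begin

section \<open>Hausdorff dimension\<close>

(* Covers are by bounded sets only, because diameter is unspecified on unbounded sets. *)
definition hausdorff_premeasure :: "real \<Rightarrow> real \<Rightarrow> 'a::metric_space set \<Rightarrow> ennreal" where
  "hausdorff_premeasure s \<delta> E =
     (INF U \<in> {U :: nat \<Rightarrow> 'a set. E \<subseteq> (\<Union>i. U i) \<and> (\<forall>i. bounded (U i) \<and> diameter (U i) \<le> \<delta>)}.
        \<Sum>i. ennreal (diameter (U i) powr s))"

definition hausdorff_measure :: "real \<Rightarrow> 'a::metric_space set \<Rightarrow> ennreal" where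
  "hausdorff_measure s E = (SUP \<delta> \<in> {0<..}. hausdorff_premeasure s \<delta> E)"

(* Only s > 0 is used: since 0 powr 0 = 0, the case s = 0 above is not the counting measure,
   and omitting it does not change the infimum.  In a Euclidean space every s larger than the
   dimension belongs to the set, so the infimum is a genuine nonnegative real. *)
definition hausdorff_dim :: "'a::euclidean_space set \<Rightarrow> real" where
  "hausdorff_dim E = Inf {s. 0 < s \<and> hausdorff_measure s E = 0}"


section \<open>Expansions and digit frequencies\<close>

(* The two kinds of bases: b = m (integer) and b = beta (non-integer). *)
definition expansion_base :: "real \<Rightarrow> bool" where
  "expansion_base b \<longleftrightarrow> (\<exists>m::nat. 2 \<le> m \<and> b = real m) \<or> (1 < b \<and> b \<notin> \<int>)"

definition T_map :: "real \<Rightarrow> real \<Rightarrow> real" where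
  "T_map b x = frac (b * x)"

(* Meaningful for k \<ge> 1. *)
definition digit :: "real \<Rightarrow> nat \<Rightarrow> real \<Rightarrow> nat" where
  "digit b k x = nat \<lfloor>b * (T_map b ^^ (k - 1)) x\<rfloor>"

(* {0, ..., m - 1} if b = m is an integer, {0, ..., [b]} otherwise. *)
definition digit_set :: "real \<Rightarrow> nat set" where
  "digit_set b = (if b \<in> \<int> then {0..<nat \<lfloor>b\<rfloor>} else {0..nat \<lfloor>b\<rfloor>})"

definition stochastic :: "real \<Rightarrow> (nat \<Rightarrow> real) \<Rightarrow> bool" where
  "stochastic b p \<longleftrightarrow> (\<forall>i\<in>digit_set b. 0 < p i) \<and> (\<Sum>i\<in>digit_set b. p i) = 1"

definition freq_set :: "real \<Rightarrow> (nat \<Rightarrow> real) \<Rightarrow> real set" where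
  "freq_set b p = {x \<in> {0..<1}. \<forall>i\<in>digit_set b.
     (\<lambda>n. real (card {j \<in> {1..n}. digit b j x = i}) / real n) \<longlonglongrightarrow> p i}"

definition quasinormal :: "real \<Rightarrow> real set" where
  "quasinormal b = (\<Union>p \<in> {p. stochastic b p}. freq_set b p)"


section \<open>Moran fractals\<close>

definition similarity :: "('a::metric_space \<Rightarrow> 'a) \<Rightarrow> bool" where
  "similarity f \<longleftrightarrow> (\<exists>r>0. \<forall>x y. dist (f x) (f y) = r * dist x y)"

(* Finite words are lists.  The letters are 0, 1, 2, ... instead of 1, 2, 3, ...; accordingly
   the second index of c (and of the coefficients gamma below) starts at 0, whereas the level
   k = length w + 1 starts at 1. *)
definition moran_collection ::
  "'a::euclidean_space set \<Rightarrow> (nat \<Rightarrow> nat \<Rightarrow> real) \<Rightarrow> (nat list \<Rightarrow> 'a set) \<Rightarrow> bool" where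
  "moran_collection J c K \<longleftrightarrow>
     K [] = J \<and>
     (\<forall>w. \<exists>f. similarity f \<and> K w = f ` J) \<and>
     (\<forall>w j. K (w @ [j]) \<subseteq> K w) \<and>
     (\<forall>w i j. i \<noteq> j \<longrightarrow> interior (K (w @ [i])) \<inter> interior (K (w @ [j])) = {}) \<and>
     (\<forall>w j. diameter (K (w @ [j])) / diameter (K w) = c (length w + 1) j)"

definition moran_fractal :: "(nat list \<Rightarrow> 'a set) \<Rightarrow> 'a set" where
  "moran_fractal K = (\<Union>\<omega>::nat \<Rightarrow> nat. \<Inter>i\<in>{1..}. K (map \<omega> [0..<i]))"

(* K x is the collection chosen for the number x. *)
definition dimension_function ::
  "(real \<Rightarrow> nat list \<Rightarrow> 'a::euclidean_space set) \<Rightarrow> real \<Rightarrow> real" where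
  "dimension_function K x = hausdorff_dim (moran_fractal (K x))"


section \<open>Pressure\<close>

definition theta :: "real \<Rightarrow> (nat \<Rightarrow> nat \<Rightarrow> real) \<Rightarrow> real" where
  "theta b \<gamma> = Max ((\<lambda>i. Inf {t. 0 < t \<and> summable (\<lambda>j. \<gamma> i j powr t)}) ` digit_set b)"

(* For 0 < gamma i j < 1 all the series converge when t > theta b gamma, so on that range
   the pressure is finite and given by this formula. *)
definition pressure :: "real \<Rightarrow> (nat \<Rightarrow> nat \<Rightarrow> real) \<Rightarrow> (nat \<Rightarrow> real) \<Rightarrow> real \<Rightarrow> real" where
  "pressure b \<gamma> p t = (\<Sum>i\<in>digit_set b. p i * ln (\<Sum>j. \<gamma> i j powr t))"

(* The exceptional case in which one and the same t > theta is a zero of every pressure function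
   (for instance, if all the vectors (gamma i j)_j coincide).  The dimension is then t for all
   quasinormal x, so the dimension function is constant and in particular continuous. *)
definition degenerate :: "real \<Rightarrow> (nat \<Rightarrow> nat \<Rightarrow> real) \<Rightarrow> bool" where
  "degenerate b \<gamma> \<longleftrightarrow> (\<exists>t>theta b \<gamma>. \<forall>i\<in>digit_set b. (\<Sum>j. \<gamma> i j powr t) = 1)"

end

theory Submission
  imports Defs "HOL-Probability.Probability" "HOL-Library.Sublist"
begin

text \<open>
  Write S_i(t) for the sum of the t-th powers of the i-th vector. At level k of the construction of
  E(x) the sum of the t-th powers of the diameters is multiplied by S_i(t), where i is the k-th digit
  of x. If the digits of x have frequencies p, then 1/n times the logarithm of the sum over the sets
  of level n converges to the pressure P(t), the p-average of log S_i(t).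

  If P(t) < 0, the sets of level n are covers whose cost tends to 0, and the t-dimensional measure
  of E(x) vanishes. If P(t) > 0, the pressure stays positive when each vector is
  truncated to its first N entries for a large N. The truncated system carries a product probability
  measure that gives a set of diameter r mass at most a constant times r^t: the construction sets of
  diameter about r contain disjoint balls of radius comparable to r, so a set of diameter r meets
  boundedly many of them. Hence the t-dimensional measure is positive. Beyond theta the pressure is
  continuous and decreases at least at the linear rate - log s, where s < 1 bounds all coefficients,
  so, being positive somewhere, it has exactly one zero there, and this zero is the dimension of E(x)
  (dimension_eq_pressure_zero). In particular the dimension depends only on p.

  The rest is about digits. For a > theta, the dimension exceeds a iff the pressure at a is
  positive, and the pressure at a is a limit of averages of Borel functions of x; this gives
  measurability. Digit frequencies do not depend on an initial block, and after a long prefix of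
  x one may continue with zeros and then with the digits of any y; so every nonempty frequency set is
  dense in the set of quasinormal numbers (freq_set_dense). Therefore every value of the dimension
  function is attained near every point, and continuity at one point would force it to be constant.

  A constant value t would be a zero of all pressure functions that belong to nonempty frequency
  sets. For non-integer bases many frequency sets are empty, since not every digit sequence
  is an expansion. But digits that are separated by sufficiently many zeros always are admissible.
  Periodic sequences of this kind provide enough frequency vectors to conclude S_i(t) = 1 for all
  i, which is the degenerate case (degenerate_if_common_zero).
\<close>

section \<open>Similarities and packings\<close>

text \<open>
  A similarity is affine, because a map that fixes the origin and scales all distances by the same
  factor is linear; in finite dimension it is therefore onto and maps balls onto balls.
\<close>
lemma similarity_scaling:
  fixes f :: "'a::euclidean_space \<Rightarrow> 'a"
  assumes "similarity f"
  obtains r where "0 < r" "\<And>x y. dist (f x) (f y) = r * dist x y"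
    "\<And>y e. f ` ball y e = ball (f y) (r * e)"
proof -
  from assms obtain r where r: "0 < r" and d: "\<And>x y. dist (f x) (f y) = r * dist x y"
    unfolding similarity_def by auto
  define g where "g = (\<lambda>x. f x - f 0)"
  have "linear g"
    by (rule scaling_linear[where c = r]) (use d in \<open>auto simp: g_def dist_norm\<close>)
  moreover have "inj g"
  proof (rule injI)
    fix x y assume "g x = g y"
    then have "r * dist x y = 0" unfolding d[symmetric] by (simp add: g_def)
    then show "x = y" using r by simp
  qed
  ultimately have "surj g" by (rule linear_inj_imp_surj)
  have surj: "\<exists>x. z = f x" for z
  proof -
    obtain x where "z - f 0 = g x" using \<open>surj g\<close> by (metis surjD)
    then show ?thesis by (auto simp: g_def)
  qed
  have "f ` ball y e = ball (f y) (r * e)" for y e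
    using surj r by (fastforce simp: d image_iff)
  then show ?thesis using that r d by blast
qed

lemma diameter_similarity_image:
  fixes f :: "'a::euclidean_space \<Rightarrow> 'a"
  assumes r: "0 < r" and d: "\<And>x y. dist (f x) (f y) = r * dist x y"
    and J: "compact J" "J \<noteq> {}"
  shows "diameter (f ` J) = r * diameter J" "compact (f ` J)"
proof -
  have "continuous_on J f"
    unfolding continuous_on_iff d
  proof (intro ballI allI impI)
    fix x and e :: real assume "0 < e"
    then show "\<exists>\<delta>>0. \<forall>x'\<in>J. dist x' x < \<delta> \<longrightarrow> r * dist x' x < e"
      using r by (intro exI[of _ "e / r"]) (auto simp: field_simps)
  qed
  then show c: "compact (f ` J)" using J(1) by (rule compact_continuous_image)
  obtain x y where "x \<in> J" "y \<in> J" "dist x y = diameter J"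
    using diameter_compact_attained J by blast
  then have "r * diameter J \<le> diameter (f ` J)"
    using diameter_bounded_bound[OF compact_imp_bounded[OF c], of "f x" "f y"] d by auto
  moreover have "diameter (f ` J) \<le> r * diameter J"
  proof (rule diameter_le)
    show "f ` J \<noteq> {} \<or> 0 \<le> r * diameter J" using J by simp
    fix u v assume "u \<in> f ` J" "v \<in> f ` J"
    then obtain x y where "x \<in> J" "y \<in> J" "u = f x" "v = f y" by auto
    then show "norm (u - v) \<le> r * diameter J"
      using d[of x y] diameter_bounded_bound[OF compact_imp_bounded[OF J(1)], of x y] r
      by (simp add: dist_norm)
  qed
  ultimately show "diameter (f ` J) = r * diameter J" by simp
qed

text \<open>
  Comparison of volumes.
\<close>
lemma card_packing_le:
  fixes z :: "'i \<Rightarrow> 'a::euclidean_space"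
  assumes "finite F" "0 < r" "0 < R"
    and disj: "disjoint_family_on (\<lambda>i. ball (z i) r) F"
    and sub: "\<And>i. i \<in> F \<Longrightarrow> ball (z i) r \<subseteq> ball u R"
  shows "real (card F) \<le> (R / r) ^ DIM('a)"
proof -
  let ?v = "unit_ball_vol (DIM('a))"
  have v: "?v > 0" by simp
  have "(\<Sum>i\<in>F. emeasure lborel (ball (z i) r)) = emeasure lborel (\<Union>i\<in>F. ball (z i) r)"
    by (rule sum_emeasure) (use assms in auto)
  also have "\<dots> \<le> emeasure lborel (ball u R)"
    by (rule emeasure_mono) (use sub in auto)
  finally have "ennreal (real (card F) * (?v * r ^ DIM('a))) \<le> ennreal (?v * R ^ DIM('a))"
    using assms(2,3) v
    by (simp add: emeasure_ball ennreal_mult ennreal_of_nat_eq_real_of_nat)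
  then have "real (card F) * (?v * r ^ DIM('a)) \<le> ?v * R ^ DIM('a)"
    using assms(2,3) v by (subst (asm) ennreal_le_iff) auto
  then have "real (card F) * r ^ DIM('a) \<le> R ^ DIM('a)"
    using v by (simp add: mult.left_commute[of "real (card F)"])
  then show ?thesis using assms(2) by (simp add: power_divide field_simps)
qed

section \<open>Moran constructions\<close>

text \<open>
  The digits of x enter a Moran construction only through the ratios c k j, so the bounds for its
  Hausdorff measure are proved for arbitrary ratios that are positive and bounded by s < 1.
\<close>
locale moran_construction =
  fixes J :: "'a::euclidean_space set" and c :: "nat \<Rightarrow> nat \<Rightarrow> real"
    and K :: "nat list \<Rightarrow> 'a set" and s :: real
  assumes compact_J: "compact J" and interior_J: "interior J \<noteq> {}" and diameter_J: "diameter J = 1"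
    and collection: "moran_collection J c K"
    and ratio_pos: "\<And>k j. 1 \<le> k \<Longrightarrow> 0 < c k j"
    and ratio_le: "\<And>k j. 1 \<le> k \<Longrightarrow> c k j \<le> s" and s_less_1: "s < 1"
begin

lemma J_nonempty: "J \<noteq> {}"
  using interior_J by auto

lemma s_pos: "0 < s"
  using ratio_pos[of 1 0] ratio_le[of 1 0] by simp

lemma K_similar:
  obtains f r where "0 < r" "\<And>x y. dist (f x) (f y) = r * dist x y"
    "\<And>y e. f ` ball y e = ball (f y) (r * e)" "K w = f ` J" "diameter (K w) = r"
proof -
  obtain f where f: "similarity f" "K w = f ` J"
    using collection unfolding moran_collection_def by blast
  obtain r where r: "0 < r" "\<And>x y. dist (f x) (f y) = r * dist x y"
    "\<And>y e. f ` ball y e = ball (f y) (r * e)" using similarity_scaling[OF f(1)] by blast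
  show ?thesis
    using that[OF r f(2)] diameter_similarity_image(1)[OF r(1,2) compact_J J_nonempty] diameter_J f(2)
    by simp
qed

lemma K_Nil: "K [] = J"
  using collection unfolding moran_collection_def by blast

lemma K_append_subset: "K (w @ v) \<subseteq> K w"
proof (induction v rule: rev_induct)
  case (snoc j v)
  have "K ((w @ v) @ [j]) \<subseteq> K (w @ v)"
    using collection unfolding moran_collection_def by blast
  then show ?case using snoc by auto
qed simp

lemma K_disjoint: "i \<noteq> j \<Longrightarrow> interior (K (w @ [i])) \<inter> interior (K (w @ [j])) = {}"
  using collection unfolding moran_collection_def by blast

lemma diameter_K_pos: "0 < diameter (K w)"
  by (rule K_similar[of w]) simp

lemma compact_K: "compact (K w)"
proof -
  obtain f r where "0 < r" "\<And>x y. dist (f x) (f y) = r * dist x y" "K w = f ` J"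
    using K_similar[of w] by metis
  then show ?thesis using diameter_similarity_image(2)[OF _ _ compact_J J_nonempty] by metis
qed

lemma K_nonempty: "K w \<noteq> {}"
  by (rule K_similar[of w]) (use J_nonempty in simp)

lemma diameter_K_snoc: "diameter (K (w @ [j])) = diameter (K w) * c (Suc (length w)) j"
proof -
  have "diameter (K (w @ [j])) / diameter (K w) = c (length w + 1) j"
    using collection unfolding moran_collection_def by blast
  then show ?thesis using diameter_K_pos[of w] by (simp add: field_simps)
qed

lemma diameter_K: "diameter (K w) = (\<Prod>k<length w. c (Suc k) (w ! k))"
proof (induction w rule: rev_induct)
  case Nil
  then show ?case by (simp add: K_Nil diameter_J)
next
  case (snoc j w)
  then show ?case by (simp add: diameter_K_snoc nth_append)
qed

lemma diameter_K_le: "diameter (K w) \<le> s ^ length w"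
proof -
  have "(\<Prod>k<length w. c (Suc k) (w ! k)) \<le> (\<Prod>k<length w. s)"
    by (intro prod_mono) (use ratio_pos ratio_le in \<open>auto simp: less_imp_le\<close>)
  then show ?thesis by (simp add: diameter_K)
qed

lemma diameter_K_append_le: "diameter (K (w @ v)) \<le> diameter (K w)"
  by (intro diameter_subset K_append_subset compact_imp_bounded compact_K)

lemma K_ball:
  assumes "ball y e \<subseteq> J"
  obtains z where "ball z (diameter (K w) * e) \<subseteq> K w"
proof -
  obtain f r where f: "\<And>y e. f ` ball y e = ball (f y) (r * e)" "K w = f ` J" "diameter (K w) = r"
    using K_similar[of w] by metis
  have "f ` ball y e \<subseteq> K w" using assms f(2) by blast
  then have "ball (f y) (diameter (K w) * e) \<subseteq> K w" by (simp only: f(1,3))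
  then show ?thesis using that by blast
qed

text \<open>
  Two incomparable words branch at a first position, and there the interiors become disjoint.
\<close>
lemma K_disjoint_parallel:
  assumes "w \<parallel> v"
  shows "interior (K w) \<inter> interior (K v) = {}"
proof -
  from parallel_decomp[OF assms] obtain u i w' j v' where
    *: "i \<noteq> j" "w = u @ i # w'" "v = u @ j # v'" by blast
  have "interior (K w) \<subseteq> interior (K (u @ [i]))" "interior (K v) \<subseteq> interior (K (u @ [j]))"
    using K_append_subset[of "u @ [i]" w'] K_append_subset[of "u @ [j]" v'] *
    by (auto intro!: interior_mono)
  then show ?thesis using K_disjoint[OF *(1), of u] by blast
qed

section \<open>Vanishing Hausdorff measure\<close>

text \<open>
  An enumeration of the words of length n + 1 by the natural numbers that is compatible with appending
  a letter. The length starts at 1 because there is only one empty word, so no sequence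
  enumerates the words of length 0 without repetition.
\<close>
primrec level_word :: "nat \<Rightarrow> nat \<Rightarrow> nat list" where
  "level_word 0 i = [i]"
| "level_word (Suc n) i = level_word n (fst (prod_decode i)) @ [snd (prod_decode i)]"

lemma length_level_word: "length (level_word n i) = Suc n"
  by (induction n arbitrary: i) auto

lemma level_word_surj: "length w = Suc n \<Longrightarrow> \<exists>i. level_word n i = w"
proof (induction n arbitrary: w)
  case 0
  then show ?case by (auto simp: length_Suc_conv)
next
  case (Suc n)
  then obtain v j where w: "w = v @ [j]" and "length v = Suc n"
    by (metis length_append_singleton length_Suc_conv_rev nat.inject)
  then obtain a where "level_word n a = v" using Suc.IH by blast
  then have "level_word (Suc n) (prod_encode (a, j)) = w" by (simp add: w)
  then show ?case by blast
qed

text \<open>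
  The double series over a word of one level and its next letter is the product of the two sums.
\<close>
lemma sum_level_words:
  assumes t: "0 < t" and summ: "\<And>k. 1 \<le> k \<Longrightarrow> summable (\<lambda>j. c k j powr t)"
  shows "(\<Sum>i. ennreal (diameter (K (level_word n i)) powr t))
    = ennreal (\<Prod>k=1..Suc n. \<Sum>j. c k j powr t)"
proof -
  have S: "(\<Sum>j. ennreal (c k j powr t)) = ennreal (\<Sum>j. c k j powr t)"
    "0 \<le> (\<Sum>j. c k j powr t)" if "1 \<le> k" for k
    using summ[OF that] by (auto intro!: suminf_ennreal2 suminf_nonneg)
  show ?thesis
  proof (induction n)
    case 0
    then show ?case by (simp add: diameter_K S)
  next
    case (Suc n)
    let ?d = "\<lambda>m. ennreal (diameter (K (level_word n m)) powr t)"
    have 1: "ennreal (diameter (K (level_word (Suc n) i)) powr t)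
      = (\<lambda>(m, j). ?d m * ennreal (c (Suc (Suc n)) j powr t)) (prod_decode i)" for i
      using diameter_K_pos ratio_pos
      by (simp add: case_prod_beta diameter_K_snoc length_level_word powr_mult ennreal_mult)
    have "(\<Sum>i. ennreal (diameter (K (level_word (Suc n) i)) powr t))
      = (\<Sum>m. ?d m * ennreal (\<Sum>j. c (Suc (Suc n)) j powr t))"
      unfolding 1 by (rule suminf_ennreal_2dimen) (simp add: S(1)[symmetric])
    also have "\<dots> = ennreal (\<Prod>k=1..Suc n. \<Sum>j. c k j powr t) * ennreal (\<Sum>j. c (Suc (Suc n)) j powr t)"
      by (simp add: Suc.IH)
    also have "\<dots> = ennreal (\<Prod>k=1..Suc (Suc n). \<Sum>j. c k j powr t)"
      by (subst ennreal_mult[symmetric]) (auto simp: S intro!: prod_nonneg mult_nonneg_nonneg)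
    finally show ?case .
  qed
qed

lemma moran_fractal_subset_level: "moran_fractal K \<subseteq> (\<Union>i. K (level_word n i))"
proof
  fix y assume "y \<in> moran_fractal K"
  then obtain \<omega> :: "nat \<Rightarrow> nat" where \<omega>: "\<And>i. 1 \<le> i \<Longrightarrow> y \<in> K (map \<omega> [0..<i])"
    unfolding moran_fractal_def by auto
  obtain i where "level_word n i = map \<omega> [0..<Suc n]"
    using level_word_surj[of "map \<omega> [0..<Suc n]" n] by auto
  then show "y \<in> (\<Union>i. K (level_word n i))" using \<omega>[of "Suc n"] by (metis UN_I UNIV_I le_add1 plus_1_eq_Suc)
qed

text \<open>
  For every large n the sets of level n form an admissible cover, since their diameters are at most
  s^n.
\<close>
lemma hausdorff_measure_eq_0:
  assumes t: "0 < t" and summ: "\<And>k. 1 \<le> k \<Longrightarrow> summable (\<lambda>j. c k j powr t)"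
    and lim: "(\<lambda>n. \<Prod>k=1..n. \<Sum>j. c k j powr t) \<longlonglongrightarrow> 0"
  shows "hausdorff_measure t (moran_fractal K) = 0"
proof -
  have "hausdorff_premeasure t \<delta> (moran_fractal K) = 0" if "0 < \<delta>" for \<delta>
  proof -
    let ?p = "\<lambda>n. \<Prod>k=1..Suc n. \<Sum>j. c k j powr t"
    have "\<forall>\<^sub>F n in sequentially. hausdorff_premeasure t \<delta> (moran_fractal K) \<le> ennreal (?p n)"
    proof -
      have "(\<lambda>n. s ^ n) \<longlonglongrightarrow> 0" using s_pos s_less_1 by (intro LIMSEQ_realpow_zero) auto
      then have "\<forall>\<^sub>F n in sequentially. s ^ n < \<delta>" using that by (rule order_tendstoD)
      then show ?thesis
      proof (rule eventually_mono)
        fix n assume "s ^ n < \<delta>"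
        then have "diameter (K (level_word n i)) \<le> \<delta>" for i
        proof -
          have "s * s ^ n \<le> s ^ n" using s_pos s_less_1 by (intro mult_left_le_one_le) auto
          then show ?thesis
            using diameter_K_le[of "level_word n i"] \<open>s ^ n < \<delta>\<close> by (simp add: length_level_word)
        qed
        then have "hausdorff_premeasure t \<delta> (moran_fractal K)
            \<le> (\<Sum>i. ennreal (diameter (K (level_word n i)) powr t))"
          unfolding hausdorff_premeasure_def using moran_fractal_subset_level
          by (intro INF_lower) (auto intro: compact_imp_bounded compact_K)
        then show "hausdorff_premeasure t \<delta> (moran_fractal K) \<le> ennreal (?p n)"
          by (simp only: sum_level_words[OF t summ])
      qed
    qed
    moreover have "(\<lambda>n. ennreal (?p n)) \<longlonglongrightarrow> ennreal 0"
      using LIMSEQ_Suc[OF lim] by (rule tendsto_ennrealI)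
    ultimately have "hausdorff_premeasure t \<delta> (moran_fractal K) \<le> ennreal 0"
      by (intro tendsto_lowerbound) auto
    then show ?thesis by simp
  qed
  then show ?thesis unfolding hausdorff_measure_def by (auto intro!: SUP_eq_const)
qed

section \<open>Positive Hausdorff measure\<close>

text \<open>
  The words in W are those at which the diameter first drops to at most r. They are pairwise
  incomparable, so their sets have disjoint interiors; and since one step shrinks a diameter at most by
  the factor a, each of these sets contains a ball of radius a r e. Those that meet U lie within
  distance 2 r of a point of U, so volume bounds their number independently of r.
\<close>
lemma stopping_words_card:
  assumes a: "0 < a" "\<And>k j. 1 \<le> k \<Longrightarrow> j < N \<Longrightarrow> a \<le> c k j"
    and e: "0 < e" "ball y e \<subseteq> J"
    and \<rho>: "0 < \<rho>" "bounded U" "diameter U \<le> \<rho>"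
  defines "W \<equiv> {w. w \<noteq> [] \<and> set w \<subseteq> {..<N} \<and> diameter (K w) \<le> \<rho> \<and> \<rho> < diameter (K (butlast w))
                  \<and> K w \<inter> U \<noteq> {}}"
  shows "finite W" "real (card W) \<le> (3 / (a * e)) ^ DIM('a)"
proof -
  have "finite W \<and> card W \<le> nat \<lfloor>(3 / (a * e)) ^ DIM('a)\<rfloor>"
  proof (rule finite_if_finite_subsets_card_bdd)
    fix F assume F: "F \<subseteq> W" "finite F"
    show "card F \<le> nat \<lfloor>(3 / (a * e)) ^ DIM('a)\<rfloor>"
    proof (cases "F = {}")
      case False
      then obtain u where u: "u \<in> U" using F(1) unfolding W_def by blast
      have ae: "0 < a * e" using a e by simp
      have "\<exists>z. ball z (diameter (K w) * e) \<subseteq> K w" for w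
        using K_ball[OF e(2), of w] by metis
      then obtain z where z: "\<And>w. ball (z w) (diameter (K w) * e) \<subseteq> K w" by metis
      have diam: "a * \<rho> \<le> diameter (K w)" if "w \<in> W" for w
      proof -
        have "w \<noteq> []" using that unfolding W_def by blast
        then obtain v j where w: "w = v @ [j]" by (metis append_butlast_last_id)
        have "j < N" "\<rho> \<le> diameter (K v)" using that unfolding W_def w by auto
        then show ?thesis using a(2)[of "Suc (length v)" j] a(1) \<rho>(1)
          by (simp add: w diameter_K_snoc mult.commute[of a] mult_mono)
      qed
      have ball: "ball (z w) (a * \<rho> * e) \<subseteq> interior (K w)" if "w \<in> W" for w
      proof (rule interior_maximal)
        have "a * \<rho> * e \<le> diameter (K w) * e" using diam[OF that] e by simp
        then show "ball (z w) (a * \<rho> * e) \<subseteq> K w" using z[of w] subset_ball by blast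
      qed simp
      have stop: "w \<parallel> v" if "w \<in> W" "v \<in> W" "w \<noteq> v" for w v
      proof -
        \<comment> \<open>A proper prefix of v is a prefix of butlast v, whose set is still too large.\<close>
        have "\<not> prefix w v" if "w \<in> W" "v \<in> W" "w \<noteq> v" for w v
        proof
          assume "prefix w v"
          then have "prefix w (butlast v)"
            using that(3) by (metis append_butlast_last_id butlast.simps(1) prefix_snoc)
          then obtain x where "butlast v = w @ x" by (auto elim: prefixE)
          then show False
            using that diameter_K_append_le[of w x] unfolding W_def by auto
        qed
        then show ?thesis using that by blast
      qed
      have "real (card F) \<le> (3 * \<rho> / (a * \<rho> * e)) ^ DIM('a)"
      proof (rule card_packing_le[where z = z and u = u])
        show "disjoint_family_on (\<lambda>w. ball (z w) (a * \<rho> * e)) F"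
          unfolding disjoint_family_on_def
        proof (intro ballI impI)
          fix w v assume "w \<in> F" "v \<in> F" "w \<noteq> v"
          then have "w \<in> W" "v \<in> W" "w \<parallel> v" using F(1) stop by blast+
          then show "ball (z w) (a * \<rho> * e) \<inter> ball (z v) (a * \<rho> * e) = {}"
            using ball K_disjoint_parallel by blast
        qed
        fix w assume "w \<in> F"
        then have w: "w \<in> W" using F by blast
        then obtain v where v: "v \<in> K w" "v \<in> U" unfolding W_def by blast
        show "ball (z w) (a * \<rho> * e) \<subseteq> ball u (3 * \<rho>)"
        proof
          fix x assume "x \<in> ball (z w) (a * \<rho> * e)"
          then have "x \<in> K w" using ball[OF w] interior_subset by blast
          then have "dist v x \<le> \<rho>"
            using diameter_bounded_bound[OF compact_imp_bounded[OF compact_K], of v w x] v w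
            unfolding W_def by simp
          moreover have "dist u v \<le> \<rho>"
            using diameter_bounded_bound[OF \<rho>(2) u v(2)] \<rho>(3) by simp
          ultimately show "x \<in> ball u (3 * \<rho>)"
            using dist_triangle[of u x v] \<rho>(1) by simp
        qed
      qed (use F a e \<rho> in auto)
      also have "3 * \<rho> / (a * \<rho> * e) = 3 / (a * e)" using \<rho>(1) by simp
      finally show ?thesis by (simp add: le_nat_floor)
    qed simp
  qed
  moreover have "0 \<le> (3 / (a * e)) ^ DIM('a)" using a e by simp
  ultimately show "finite W" "real (card W) \<le> (3 / (a * e)) ^ DIM('a)"
    using of_nat_floor[of "(3 / (a * e)) ^ DIM('a)"] of_nat_mono[where 'a = real]
    by (meson order_trans)+
qed

text \<open>
  The mass distribution principle for the words over the first N letters. Level k of the product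
  measure gives the letter j a mass proportional to c k j powr t. The normalising factors multiply to
  at least m, so a cylinder has mass at most diam^t / m, and with the bound for stopping words the
  points of the fractal in a set of diameter r have mass at most B r^t. A cover of total cost below
  1 / B would therefore have total mass less than 1. The measure lives on the sequences of letters
  rather than in the space, so that the covering sets may be arbitrary.
  
  Positivity is stated for all exponents u below t as well, because in the definition of the dimension
  the infimum runs over all exponents at which the measure vanishes.
\<close>
lemma hausdorff_measure_pos:
  assumes t: "0 < t" and u: "0 < u" "u \<le> t"
    and a: "0 < a" "\<And>k j. 1 \<le> k \<Longrightarrow> j < N \<Longrightarrow> a \<le> c k j"
    and mass: "0 < m" "\<And>n. m \<le> (\<Prod>k=1..n. \<Sum>j<N. c k j powr t)"
  shows "0 < hausdorff_measure u (moran_fractal K)"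
proof -
  define q where "q k = (\<Sum>j<N. c (Suc k) j powr t)" for k
  have N: "0 < N"
  proof (rule ccontr)
    assume "\<not> 0 < N"
    then show False using mass(1) mass(2)[of 1] by simp
  qed
  have q_pos: "0 < q k" for k
  proof -
    have "c (Suc k) j \<noteq> 0" for j using ratio_pos[of "Suc k" j] by simp
    then show ?thesis unfolding q_def using N by (intro sum_pos) auto
  qed
  have q_prod: "m \<le> (\<Prod>k<n. q k)" for n
    using mass(2)[of n] unfolding q_def
    by (simp add: prod.atLeast1_atMost_eq lessThan_Suc_atMost)
  define M where "M k = point_measure {..<N} (\<lambda>j. ennreal (c (Suc k) j powr t / q k))" for k
  have M_prob: "prob_space (M k)" for k
  proof -
    have "(\<Sum>j<N. ennreal (c (Suc k) j powr t / q k)) = ennreal (\<Sum>j<N. c (Suc k) j powr t / q k)"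
      by (intro sum_ennreal) (use q_pos in \<open>auto simp: less_imp_le\<close>)
    also have "(\<Sum>j<N. c (Suc k) j powr t / q k) = 1"
      using q_pos[of k] by (simp add: q_def sum_divide_distrib[symmetric])
    finally show ?thesis unfolding M_def by (intro prob_space_point_measure) auto
  qed
  interpret P: product_prob_space M UNIV
    by (rule product_prob_spaceI) (rule M_prob)
  let ?P = "Pi\<^sub>M UNIV M"
  have space_P: "space ?P = {\<omega>. \<forall>k. \<omega> k < N}"
    by (auto simp: space_PiM M_def space_point_measure PiE_iff)
  define cyl where "cyl w = {\<omega> \<in> space ?P. \<forall>k\<in>{..<length w}. \<omega> k \<in> {w ! k}}" for w :: "nat list"
  have cyl: "cyl w \<in> sets ?P" "emeasure ?P (cyl w) \<le> ennreal (diameter (K w) powr t / m)"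
    if w: "set w \<subseteq> {..<N}" for w
  proof -
    have sets: "{w ! k} \<in> sets (M k)" if "k < length w" for k
      using w that nth_mem by (fastforce simp: M_def sets_point_measure)
    then show "cyl w \<in> sets ?P" unfolding cyl_def
      by (intro sets_PiM_I_finite sets.sets_Collect_finite_All) (auto intro!: measurable_sets_Collect measurable_component_singleton)
    have "emeasure ?P (cyl w) = (\<Prod>k<length w. emeasure (M k) {w ! k})"
      unfolding cyl_def by (rule P.emeasure_PiM_Collect) (use sets in auto)
    also have "\<dots> = (\<Prod>k<length w. ennreal (c (Suc k) (w ! k) powr t / q k))"
      using w nth_mem by (intro prod.cong) (fastforce simp: M_def emeasure_point_measure_finite)+
    also have "\<dots> = ennreal (\<Prod>k<length w. c (Suc k) (w ! k) powr t / q k)"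
      by (intro prod_ennreal) (use q_pos in \<open>auto simp: less_imp_le\<close>)
    also have "(\<Prod>k<length w. c (Suc k) (w ! k) powr t / q k)
        = diameter (K w) powr t / (\<Prod>k<length w. q k)"
      using ratio_pos by (simp add: prod_dividef diameter_K prod_powr_distrib less_imp_le)
    also have "\<dots> \<le> diameter (K w) powr t / m"
      using mass(1) q_prod[of "length w"] by (intro divide_left_mono mult_pos_pos) (auto intro: less_le_trans)
    finally show "emeasure ?P (cyl w) \<le> ennreal (diameter (K w) powr t / m)"
      by (simp add: ennreal_leI)
  qed
  obtain y e where e: "0 < e" "ball y e \<subseteq> J"
    using interior_J by (meson ex_in_conv mem_interior)
  define B where "B = (3 / (a * e)) ^ DIM('a) / m"
  have B: "0 < B" unfolding B_def using a e mass by simp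
  \<comment> \<open>The sequences whose points lie in a set of diameter at most r are covered by few cylinders.\<close>
  have small: "\<exists>A\<in>sets ?P. {\<omega> \<in> space ?P. (\<Inter>i\<in>{1..}. K (map \<omega> [0..<i])) \<inter> U \<noteq> {}} \<subseteq> A
      \<and> emeasure ?P A \<le> ennreal (B * \<rho> powr t)"
    if \<rho>: "0 < \<rho>" "\<rho> < 1" "bounded U" "diameter U \<le> \<rho>" for \<rho> U
  proof -
    define W where "W = {w. w \<noteq> [] \<and> set w \<subseteq> {..<N} \<and> diameter (K w) \<le> \<rho>
      \<and> \<rho> < diameter (K (butlast w)) \<and> K w \<inter> U \<noteq> {}}"
    have W: "finite W" "real (card W) \<le> (3 / (a * e)) ^ DIM('a)"
      using stopping_words_card[OF a e \<rho>(1,3,4)] unfolding W_def by auto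
    have "{\<omega> \<in> space ?P. (\<Inter>i\<in>{1..}. K (map \<omega> [0..<i])) \<inter> U \<noteq> {}} \<subseteq> (\<Union>w\<in>W. cyl w)"
    proof
      fix \<omega> assume "\<omega> \<in> {\<omega> \<in> space ?P. (\<Inter>i\<in>{1..}. K (map \<omega> [0..<i])) \<inter> U \<noteq> {}}"
      then obtain x where \<omega>: "\<omega> \<in> space ?P" "x \<in> U" and x: "\<And>i. 1 \<le> i \<Longrightarrow> x \<in> K (map \<omega> [0..<i])"
        by auto
      have "(\<lambda>n. s ^ n) \<longlonglongrightarrow> 0" using s_pos s_less_1 by (intro LIMSEQ_realpow_zero) auto
      then have "\<forall>\<^sub>F n in sequentially. s ^ n < \<rho>" using \<rho>(1) by (rule order_tendstoD)
      then obtain n where "s ^ n < \<rho>" by (auto simp: eventually_sequentially)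
      then have ex: "diameter (K (map \<omega> [0..<n])) \<le> \<rho>" using diameter_K_le[of "map \<omega> [0..<n]"] by simp
      define l where "l = (LEAST n. diameter (K (map \<omega> [0..<n])) \<le> \<rho>)"
      have l: "diameter (K (map \<omega> [0..<l])) \<le> \<rho>" unfolding l_def using ex by (rule LeastI)
      have "l \<noteq> 0" using l \<rho>(2) by (cases l) (simp_all add: K_Nil diameter_J)
      then obtain l' where l': "l = Suc l'" by (cases l) auto
      have "\<rho> < diameter (K (map \<omega> [0..<l']))"
        using not_less_Least[of l' "\<lambda>n. diameter (K (map \<omega> [0..<n])) \<le> \<rho>"] l'
        unfolding l_def by simp
      then have "map \<omega> [0..<l] \<in> W"
        unfolding W_def using l x[of l] \<omega> by (auto simp: l' space_P)
      moreover have "\<omega> \<in> cyl (map \<omega> [0..<l])" using \<omega> by (simp add: cyl_def)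
      ultimately show "\<omega> \<in> (\<Union>w\<in>W. cyl w)" by blast
    qed
    moreover have "(\<Union>w\<in>W. cyl w) \<in> sets ?P"
      using W cyl(1) by (intro sets.finite_UN) (auto simp: W_def)
    moreover have "emeasure ?P (\<Union>w\<in>W. cyl w) \<le> ennreal (B * \<rho> powr t)"
    proof -
      have "emeasure ?P (\<Union>w\<in>W. cyl w) \<le> (\<Sum>w\<in>W. emeasure ?P (cyl w))"
        using W cyl(1) by (intro emeasure_subadditive_finite) (auto simp: W_def)
      also have "\<dots> \<le> (\<Sum>w\<in>W. ennreal (\<rho> powr t / m))"
      proof (rule sum_mono)
        fix w assume "w \<in> W"
        then have w: "set w \<subseteq> {..<N}" "diameter (K w) \<le> \<rho>" by (auto simp: W_def)
        have "diameter (K w) powr t / m \<le> \<rho> powr t / m"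
          using w diameter_K_pos[of w] t mass(1) by (intro divide_right_mono powr_mono2) auto
        then show "emeasure ?P (cyl w) \<le> ennreal (\<rho> powr t / m)"
          using cyl(2)[OF w(1)] by (meson ennreal_leI order_trans)
      qed
      also have "\<dots> = ennreal (real (card W) * (\<rho> powr t / m))"
        using mass(1) by (subst ennreal_mult) (auto simp: ennreal_of_nat_eq_real_of_nat)
      also have "\<dots> \<le> ennreal (B * \<rho> powr t)"
      proof (rule ennreal_leI)
        have "real (card W) * (\<rho> powr t / m) \<le> (3 / (a * e)) ^ DIM('a) * (\<rho> powr t / m)"
          using W(2) mass(1) by (intro mult_right_mono) auto
        then show "real (card W) * (\<rho> powr t / m) \<le> B * \<rho> powr t" by (simp add: B_def)
      qed
      finally show ?thesis .
    qed
    ultimately show ?thesis by blast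
  qed
  \<comment> \<open>Diameters at most 1/2 keep the auxiliary radii below 1 = diameter J.\<close>
  have "ennreal (1 / B) \<le> hausdorff_premeasure u (1/2) (moran_fractal K)"
    unfolding hausdorff_premeasure_def
  proof (rule INF_greatest)
    fix U assume "U \<in> {U :: nat \<Rightarrow> 'a set. moran_fractal K \<subseteq> (\<Union>i. U i)
      \<and> (\<forall>i. bounded (U i) \<and> diameter (U i) \<le> 1/2)}"
    then have cover: "moran_fractal K \<subseteq> (\<Union>i. U i)"
      and U: "\<And>i. bounded (U i)" "\<And>i. diameter (U i) \<le> 1/2" by auto
    have dU: "0 \<le> diameter (U i)" for i using U by (simp add: diameter_ge_0)
    let ?S = "\<Sum>i. ennreal (diameter (U i) powr t)"
    have "1 \<le> ennreal B * ?S"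
    proof (rule ennreal_le_epsilon)
      fix d :: real assume "0 < d"
      define \<epsilon> where "\<epsilon> = min (1/2) (d / B)"
      have \<epsilon>: "0 < \<epsilon>" "\<epsilon> < 1" "B * \<epsilon> \<le> d"
        using \<open>0 < d\<close> B by (auto simp: \<epsilon>_def min_def field_simps)
      \<comment> \<open>Sets of diameter 0 cost nothing, but the mass bound needs a positive radius;
        the geometric weights make the additional cost at most \<epsilon>.\<close>
      define \<rho> where "\<rho> i = (if 0 < diameter (U i) then diameter (U i) else (\<epsilon> * (1/2) ^ Suc i) powr (1/t))" for i
      have eps: "\<epsilon> * (1/2) ^ Suc i < 1" for i
        using \<epsilon> mult_strict_mono[of \<epsilon> 1 "(1/2) ^ Suc i" "1::real"] power_Suc_less_one[of "1/2::real" i]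
        by (simp del: power_Suc)
      have \<rho>: "0 < \<rho> i" "\<rho> i < 1" "diameter (U i) \<le> \<rho> i" for i
      proof -
        have "0 < \<epsilon> * (1/2) ^ Suc i" using \<epsilon>(1) by simp
        then have "0 < (\<epsilon> * (1/2) ^ Suc i) powr (1/t)" "(\<epsilon> * (1/2) ^ Suc i) powr (1/t) < 1"
          using eps[of i] t powr_less_mono2[of "1/t" "\<epsilon> * (1/2) ^ Suc i" 1] by auto
        then show "0 < \<rho> i" "\<rho> i < 1" "diameter (U i) \<le> \<rho> i"
          using U(2)[of i] dU[of i] by (auto simp: \<rho>_def not_less simp del: power_Suc intro: order_trans[of _ 0])
      qed
      have \<rho>t: "\<rho> i powr t \<le> diameter (U i) powr t + \<epsilon> * (1/2) ^ Suc i" for i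
        using \<epsilon>(1) t by (auto simp: \<rho>_def powr_powr)
      have "\<forall>i. \<exists>A. A \<in> sets ?P \<and> {\<omega> \<in> space ?P. (\<Inter>n\<in>{1..}. K (map \<omega> [0..<n])) \<inter> U i \<noteq> {}} \<subseteq> A
          \<and> emeasure ?P A \<le> ennreal (B * \<rho> i powr t)"
        using small[OF \<rho>(1,2) U(1) \<rho>(3)] by blast
      from choice[OF this] obtain A where A: "\<And>i. A i \<in> sets ?P"
        "\<And>i. {\<omega> \<in> space ?P. (\<Inter>n\<in>{1..}. K (map \<omega> [0..<n])) \<inter> U i \<noteq> {}} \<subseteq> A i"
        "\<And>i. emeasure ?P (A i) \<le> ennreal (B * \<rho> i powr t)" by blast
      have "space ?P \<subseteq> (\<Union>i. A i)"
      proof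
        fix \<omega> assume \<omega>: "\<omega> \<in> space ?P"
        have "\<Inter> (range (\<lambda>n. K (map \<omega> [0..<n]))) \<noteq> {}"
        proof (rule compact_nest)
          fix m n :: nat assume "m \<le> n"
          then have "[0..<n] = [0..<m] @ [m..<n]" by (metis le_add_diff_inverse upt_add_eq_append zero_le)
          then show "K (map \<omega> [0..<n]) \<subseteq> K (map \<omega> [0..<m])" using K_append_subset by simp
        qed (auto simp: compact_K K_nonempty)
        then obtain x where x: "\<And>n. x \<in> K (map \<omega> [0..<n])" by auto
        then have "x \<in> moran_fractal K" unfolding moran_fractal_def by auto
        then obtain i where "x \<in> U i" using cover by blast
        then have "\<omega> \<in> A i" using A(2)[of i] \<omega> x by auto
        then show "\<omega> \<in> (\<Union>i. A i)" by blast
      qed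
      then have "emeasure ?P (space ?P) \<le> emeasure ?P (\<Union>i. A i)"
        using A(1) by (intro emeasure_mono) auto
      also have "\<dots> \<le> (\<Sum>i. emeasure ?P (A i))"
        using A(1) by (intro emeasure_subadditive_countably) auto
      also have "\<dots> \<le> (\<Sum>i. ennreal B * ennreal (diameter (U i) powr t) + ennreal (B * \<epsilon> * (1/2) ^ Suc i))"
      proof (intro suminf_le summableI)
        fix i
        have "B * \<rho> i powr t \<le> B * (diameter (U i) powr t + \<epsilon> * (1/2) ^ Suc i)"
          using \<rho>t[of i] B by simp
        also have "\<dots> = B * diameter (U i) powr t + B * \<epsilon> * (1/2) ^ Suc i"
          by (simp add: algebra_simps)
        finally have "ennreal (B * \<rho> i powr t) \<le> ennreal (B * diameter (U i) powr t + B * \<epsilon> * (1/2) ^ Suc i)"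
          by (rule ennreal_leI)
        then show "emeasure ?P (A i) \<le> ennreal B * ennreal (diameter (U i) powr t) + ennreal (B * \<epsilon> * (1/2) ^ Suc i)"
          using A(3)[of i] B \<epsilon>(1) by (simp add: ennreal_mult del: power_Suc)
      qed
      also have "\<dots> = ennreal B * ?S + (\<Sum>i. ennreal (B * \<epsilon> * (1/2) ^ Suc i))"
        by (subst suminf_add[symmetric]) (auto intro: summableI)
      also have "(\<Sum>i. ennreal (B * \<epsilon> * (1/2) ^ Suc i)) = ennreal (B * \<epsilon>)"
        using sums_mult[OF power_half_series, of "B * \<epsilon>"] B \<epsilon>
        by (intro suminf_ennreal_eq) auto
      also have "ennreal B * ?S + \<dots> \<le> ennreal B * ?S + ennreal d"
        using \<epsilon>(3) by (intro add_left_mono ennreal_leI)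
      finally show "1 \<le> ennreal B * ?S + ennreal d" by (simp add: P.emeasure_space_1)
    qed
    then have "ennreal (1 / B) * 1 \<le> ennreal (1 / B) * (ennreal B * ?S)" by (rule mult_left_mono) simp
    also have "\<dots> = ?S" using B by (simp add: mult.assoc[symmetric] ennreal_mult[symmetric])
    also have "\<dots> \<le> (\<Sum>i. ennreal (diameter (U i) powr u))"
    proof (intro suminf_le summableI ennreal_leI)
      fix i show "diameter (U i) powr t \<le> diameter (U i) powr u"
        using dU[of i] U(2)[of i] u by (cases "diameter (U i) = 0") (auto intro: powr_mono')
    qed
    finally show "ennreal (1 / B) \<le> (\<Sum>i. ennreal (diameter (U i) powr u))" by simp
  qed
  also have "\<dots> \<le> hausdorff_measure u (moran_fractal K)"
    unfolding hausdorff_measure_def by (intro SUP_upper) auto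
  finally show ?thesis using B by (auto simp: ennreal_less_zero_iff intro: less_le_trans[rotated])
qed

end

section \<open>Averages along sequences\<close>

lemma mean_tendsto_shift:
  fixes f :: "nat \<Rightarrow> real"
  assumes "(\<lambda>n. (\<Sum>k=1..n. f (k + m)) / real n) \<longlonglongrightarrow> l"
  shows "(\<lambda>n. (\<Sum>k=1..n. f k) / real n) \<longlonglongrightarrow> l"
proof -
  have split: "(\<Sum>k=1..n + m. f k) = (\<Sum>k=1..m. f k) + (\<Sum>k=1..n. f (k + m))" for n
    by (induction n) (auto simp: add.commute)
  have null: "(\<lambda>n. a / real (n + m)) \<longlonglongrightarrow> 0" for a
    by (rule LIMSEQ_ignore_initial_segment[OF lim_const_over_n])
  have "(\<lambda>n. 1 - real m / real (n + m)) \<longlonglongrightarrow> 1 - 0"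
    by (intro tendsto_diff tendsto_const null)
  moreover have "\<forall>\<^sub>F n in sequentially. 1 - real m / real (n + m) = real n / real (n + m)"
    using eventually_gt_at_top[of 0] by eventually_elim (simp add: field_simps)
  ultimately have "(\<lambda>n. real n / real (n + m)) \<longlonglongrightarrow> 1"
    using Lim_transform_eventually by force
  moreover have "(\<lambda>n. (\<Sum>k=1..m. f k) / real (n + m)) \<longlonglongrightarrow> 0"
    by (rule null)
  ultimately have "(\<lambda>n. (\<Sum>k=1..m. f k) / real (n + m)
      + (\<Sum>k=1..n. f (k + m)) / real n * (real n / real (n + m))) \<longlonglongrightarrow> 0 + l * 1"
    using assms by (intro tendsto_intros)
  moreover have "\<forall>\<^sub>F n in sequentially. (\<Sum>k=1..m. f k) / real (n + m)
      + (\<Sum>k=1..n. f (k + m)) / real n * (real n / real (n + m)) = (\<Sum>k=1..n + m. f k) / real (n + m)"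
    using eventually_gt_at_top[of 0] by eventually_elim (unfold split, simp add: add_divide_distrib)
  ultimately have "(\<lambda>n. (\<Sum>k=1..n + m. f k) / real (n + m)) \<longlonglongrightarrow> l"
    using Lim_transform_eventually by force
  then show ?thesis by (rule LIMSEQ_offset)
qed

text \<open>
  The partial sums minus n times the mean over a period form a periodic, hence bounded, sequence.
\<close>
lemma mean_tendsto_periodic:
  fixes f :: "nat \<Rightarrow> real"
  assumes P: "0 < P" and f: "\<And>k. 1 \<le> k \<Longrightarrow> f (k + P) = f k"
  shows "(\<lambda>n. (\<Sum>k=1..n. f k) / real n) \<longlonglongrightarrow> (\<Sum>k=1..P. f k) / real P"
proof -
  define a where "a = (\<Sum>k=1..P. f k) / real P"
  define g where "g n = (\<Sum>k=1..n. f k) - real n * a" for n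
  have g_period: "g (n + P) = g n" for n
  proof -
    have "(\<Sum>k=1..n + P. f k) = (\<Sum>k=1..P. f k) + (\<Sum>k=1..n. f k)"
    proof (induction n)
      case (Suc n)
      then show ?case using f[of "Suc n"] by simp
    qed simp
    moreover have "real P * a = (\<Sum>k=1..P. f k)" using P by (simp add: a_def)
    ultimately show ?thesis by (simp add: g_def algebra_simps)
  qed
  have "g n = g (n mod P)" for n
  proof (induction n rule: less_induct)
    case (less n)
    show ?case
    proof (cases "n < P")
      case False
      then have "g (n - P) = g n" using g_period[of "n - P"] by simp
      then show ?thesis using less[of "n - P"] False P by (simp add: le_mod_geq)
    qed simp
  qed
  then have bound: "\<bar>g n\<bar> \<le> Max ((\<lambda>n. \<bar>g n\<bar>) ` {..<P})" for n
    using P by (metis (no_types, lifting) Max_ge finite_imageI finite_lessThan image_eqI lessThan_iff mod_less_divisor)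
  have "(\<lambda>n. g n / real n) \<longlonglongrightarrow> 0"
  proof (rule Lim_null_comparison)
    show "\<forall>\<^sub>F n in sequentially. norm (g n / real n) \<le> Max ((\<lambda>n. \<bar>g n\<bar>) ` {..<P}) / real n"
      using bound by (simp add: divide_right_mono)
  qed (rule lim_const_over_n)
  then have "(\<lambda>n. a + g n / real n) \<longlonglongrightarrow> a + 0"
    by (intro tendsto_add tendsto_const)
  moreover have "\<forall>\<^sub>F n in sequentially. a + g n / real n = (\<Sum>k=1..n. f k) / real n"
    using eventually_gt_at_top[of 0] by eventually_elim (simp add: g_def field_simps)
  ultimately show ?thesis unfolding a_def[symmetric] using Lim_transform_eventually by force
qed

section \<open>Expansions and digit frequencies\<close>

lemma card_eq_sum_of_bool:
  fixes n :: nat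
  shows "real (card {j \<in> {1..n}. P j}) = (\<Sum>j=1..n. of_bool (P j))"
proof -
  have "(\<Sum>j=1..n. of_bool (P j)) = (\<Sum>j | j \<in> {1..n} \<and> P j. 1 :: real)"
    unfolding of_bool_def by (rule sum.inter_filter[symmetric]) simp
  then show ?thesis by simp
qed

lemma expansion_base_gt_1: "expansion_base b \<Longrightarrow> 1 < b"
  unfolding expansion_base_def by auto

lemma digit_set_iff:
  assumes "expansion_base b"
  shows "i \<in> digit_set b \<longleftrightarrow> real i < b"
proof (cases "b \<in> \<int>")
  case True
  then obtain m where m: "b = of_int m" by (rule Ints_cases)
  have "1 < m" using expansion_base_gt_1[OF assms] m by simp
  then show ?thesis using m by (auto simp: digit_set_def zless_nat_eq_int_zless)
next
  case False
  have "1 < b" using expansion_base_gt_1[OF assms] .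
  have "i \<in> digit_set b \<longleftrightarrow> int i \<le> \<lfloor>b\<rfloor>"
    using False \<open>1 < b\<close> by (auto simp: digit_set_def le_nat_iff)
  also have "\<dots> \<longleftrightarrow> real i \<le> b" by (simp add: le_floor_iff)
  also have "\<dots> \<longleftrightarrow> real i < b" using False by (metis Ints_of_nat order_le_less order_less_le)
  finally show ?thesis .
qed

lemma finite_digit_set: "finite (digit_set b)"
  by (simp add: digit_set_def)

lemma T_iter_in:
  assumes "x \<in> {0..<1}"
  shows "(T_map b ^^ n) x \<in> {0..<1}"
proof (cases n)
  case (Suc m)
  then show ?thesis using frac_ge_0 frac_lt_1 by (auto simp: T_map_def)
qed (use assms in simp)

lemma T_iter_step:
  assumes "expansion_base b" "x \<in> {0..<1}"
  shows "b * (T_map b ^^ n) x = real (digit b (Suc n) x) + (T_map b ^^ Suc n) x"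
proof -
  have "0 \<le> b * (T_map b ^^ n) x"
    using T_iter_in[OF assms(2), of n b] expansion_base_gt_1[OF assms(1)] by simp
  then show ?thesis by (simp add: digit_def T_map_def frac_def)
qed

lemma digit_in_digit_set:
  assumes "expansion_base b" "x \<in> {0..<1}" "1 \<le> k"
  shows "digit b k x \<in> digit_set b"
proof -
  obtain n where k: "k = Suc n" using assms(3) by (cases k) auto
  have "b * (T_map b ^^ n) x < b"
    using T_iter_in[OF assms(2), of n b] expansion_base_gt_1[OF assms(1)] by simp
  moreover have "0 \<le> (T_map b ^^ Suc n) x" using T_iter_in[OF assms(2), of "Suc n" b] by simp
  ultimately show ?thesis
    using T_iter_step[OF assms(1,2), of n] by (simp add: k digit_set_iff[OF assms(1)] del: funpow.simps)
qed

lemma digit_shift: "1 \<le> k \<Longrightarrow> digit b k ((T_map b ^^ n) x) = digit b (k + n) x"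
  using funpow_add[of "k - 1" n "T_map b"] by (simp add: digit_def)

lemma T_map_digit_add:
  assumes "0 \<le> y" "y < 1" "b * x = real i + y"
  shows "T_map b x = y" "nat \<lfloor>b * x\<rfloor> = i"
proof -
  have "\<lfloor>b * x\<rfloor> = int i" using assms by (intro floor_unique) auto
  then show "T_map b x = y" "nat \<lfloor>b * x\<rfloor> = i" using assms by (auto simp: T_map_def frac_def)
qed

lemma divide_power_less_1:
  fixes b y :: real
  assumes "1 < b" "0 \<le> y" "y < 1"
  shows "y / b ^ m < 1"
  using assms order_less_le_trans[OF assms(3) one_le_power[of b m]] by (simp add: divide_less_eq)

lemma T_iter_divide_power:
  assumes b: "1 < b" and y: "0 \<le> y" "y < 1"
  shows "k \<le> m \<Longrightarrow> (T_map b ^^ k) (y / b ^ m) = y / b ^ (m - k)"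
proof (induction k)
  case (Suc k)
  have "y / b ^ (m - Suc k) < 1" using b y by (rule divide_power_less_1)
  moreover have "b * (y / b ^ (m - k)) = y / b ^ (m - Suc k)"
    using Suc.prems b by (simp add: Suc_diff_Suc[symmetric])
  ultimately have "T_map b (y / b ^ (m - k)) = y / b ^ (m - Suc k)"
    using b y by (intro T_map_digit_add(1)[where i = 0]) auto
  then show ?case using Suc by simp
qed simp

lemma T_iter_le:
  assumes "expansion_base b" "x \<in> {0..<1}"
  shows "(T_map b ^^ (n + j)) x \<le> b ^ j * (T_map b ^^ n) x"
proof (induction j)
  case (Suc j)
  have "(T_map b ^^ Suc (n + j)) x \<le> b * (T_map b ^^ (n + j)) x"
    using T_iter_step[OF assms, of "n + j"] by (simp del: funpow.simps)
  also have "\<dots> \<le> b * (b ^ j * (T_map b ^^ n) x)"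
    using Suc expansion_base_gt_1[OF assms(1)] by (intro mult_left_mono) auto
  finally show ?case by (simp add: mult.assoc)
qed simp

text \<open>
  The point z has the same first n digits as x: decreasing the n-th iterate from its value at x to
  any smaller nonnegative value v moves the earlier iterates by less than it takes to change
  a digit. In terms of expansions, the tail of x may be replaced by any smaller tail.
\<close>
lemma T_iter_perturb:
  assumes b: "expansion_base b" and x: "x \<in> {0..<1}" and v: "0 \<le> v" "v \<le> (T_map b ^^ n) x"
  defines "z \<equiv> x - ((T_map b ^^ n) x - v) / b ^ n"
  shows "z \<in> {0..<1}" "(T_map b ^^ n) z = v"
proof -
  let ?d = "(T_map b ^^ n) x - v"
  note b1 = expansion_base_gt_1[OF b]
  have range: "0 \<le> (T_map b ^^ k) x - ?d / b ^ (n - k)" "(T_map b ^^ k) x - ?d / b ^ (n - k) < 1"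
    if "k \<le> n" for k
  proof -
    have "?d \<le> b ^ (n - k) * (T_map b ^^ k) x"
      using T_iter_le[OF b x, of k "n - k"] v that by simp
    then show "0 \<le> (T_map b ^^ k) x - ?d / b ^ (n - k)" using b1 by (simp add: field_simps)
    have "0 \<le> ?d / b ^ (n - k)" using v b1 by simp
    then show "(T_map b ^^ k) x - ?d / b ^ (n - k) < 1" using T_iter_in[OF x, of k b] by simp
  qed
  have "(T_map b ^^ k) z = (T_map b ^^ k) x - ?d / b ^ (n - k)" if "k \<le> n" for k
    using that
  proof (induction k)
    case (Suc k)
    have "b * ?d / b ^ (n - k) = ?d / b ^ (n - Suc k)"
      using Suc.prems b1 by (simp add: Suc_diff_Suc[symmetric])
    then have "b * ((T_map b ^^ k) x - ?d / b ^ (n - k))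
        = real (digit b (Suc k) x) + ((T_map b ^^ Suc k) x - ?d / b ^ (n - Suc k))"
      using T_iter_step[OF b x, of k] by (simp add: right_diff_distrib del: funpow.simps)
    then have "T_map b ((T_map b ^^ k) x - ?d / b ^ (n - k)) = (T_map b ^^ Suc k) x - ?d / b ^ (n - Suc k)"
      using range[OF Suc.prems] by (intro T_map_digit_add(1))
    then show ?case using Suc by simp
  qed (simp add: z_def)
  from this[of n] show "(T_map b ^^ n) z = v" by simp
  show "z \<in> {0..<1}" using range[of 0] by (simp add: z_def)
qed

lemma freq_set_iff_mean:
  "x \<in> freq_set b p \<longleftrightarrow> x \<in> {0..<1} \<and> (\<forall>i\<in>digit_set b.
     (\<lambda>n. (\<Sum>k=1..n. of_bool (digit b k x = i)) / real n) \<longlonglongrightarrow> p i)"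
  unfolding freq_set_def card_eq_sum_of_bool by simp

text \<open>
  Sorting the terms by the value of the digit turns an average into a combination of frequencies.
\<close>
lemma freq_set_mean:
  assumes b: "expansion_base b" and x: "x \<in> freq_set b p"
  shows "(\<lambda>n. (\<Sum>k=1..n. g (digit b k x)) / real n) \<longlonglongrightarrow> (\<Sum>i\<in>digit_set b. p i * g i)"
proof -
  have x01: "x \<in> {0..<1}" using x by (simp add: freq_set_def)
  have "(\<Sum>k=1..n. g (digit b k x)) / real n
      = (\<Sum>i\<in>digit_set b. (\<Sum>k=1..n. of_bool (digit b k x = i)) / real n * g i)" for n
  proof -
    have "g (digit b k x) = (\<Sum>i\<in>digit_set b. of_bool (digit b k x = i) * g i)" if "k \<in> {1..n}" for k
      using digit_in_digit_set[OF b x01, of k] that finite_digit_set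
      by (simp add: of_bool_def if_distrib[of "\<lambda>c. c * _"] sum.delta' cong: if_cong)
    then have "(\<Sum>k=1..n. g (digit b k x)) = (\<Sum>k=1..n. \<Sum>i\<in>digit_set b. of_bool (digit b k x = i) * g i)"
      by (rule sum.cong[OF refl])
    also have "\<dots> = (\<Sum>i\<in>digit_set b. (\<Sum>k=1..n. of_bool (digit b k x = i)) * g i)"
      by (subst sum.swap) (simp add: sum_distrib_right)
    finally show ?thesis by (simp add: sum_divide_distrib)
  qed
  moreover have "(\<lambda>n. \<Sum>i\<in>digit_set b. (\<Sum>k=1..n. of_bool (digit b k x = i)) / real n * g i)
      \<longlonglongrightarrow> (\<Sum>i\<in>digit_set b. p i * g i)"
    by (intro tendsto_sum tendsto_mult_right) (use x freq_set_iff_mean in blast)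
  ultimately show ?thesis by simp
qed

lemma freq_set_T_iter:
  assumes x: "x \<in> {0..<1}" and T: "(T_map b ^^ n) x \<in> freq_set b p"
  shows "x \<in> freq_set b p"
  unfolding freq_set_iff_mean
proof (intro conjI ballI x)
  fix i assume "i \<in> digit_set b"
  then have "(\<lambda>N. (\<Sum>k=1..N. of_bool (digit b k ((T_map b ^^ n) x) = i)) / real N) \<longlonglongrightarrow> p i"
    using T freq_set_iff_mean by blast
  then have "(\<lambda>N. (\<Sum>k=1..N. of_bool (digit b (k + n) x = i)) / real N) \<longlonglongrightarrow> p i"
    by (simp add: digit_shift)
  then show "(\<lambda>N. (\<Sum>k=1..N. of_bool (digit b k x = i)) / real N) \<longlonglongrightarrow> p i"
    by (rule mean_tendsto_shift)
qed

text \<open>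
  If an iterate is 0, all later digits are 0 and the digit 1 has frequency 0.
\<close>
lemma quasinormal_T_iter_pos:
  assumes b: "expansion_base b" and p: "stochastic b p" and x: "x \<in> freq_set b p"
  shows "0 < (T_map b ^^ n) x"
proof (rule ccontr)
  assume "\<not> 0 < (T_map b ^^ n) x"
  moreover have x01: "x \<in> {0..<1}" using x by (simp add: freq_set_def)
  ultimately have "(T_map b ^^ n) x = 0" using T_iter_in[OF x01, of n b] by simp
  then have "(T_map b ^^ (n + k)) x \<le> 0" for k
    using T_iter_le[OF b x01, of n k] by simp
  then have zero: "(T_map b ^^ (n + k)) x = 0" for k
    using T_iter_in[OF x01, of "n + k" b] by (simp add: antisym)
  have digit: "digit b (Suc (n + k)) x = 0" for k
    by (simp add: digit_def zero)
  have "{j \<in> {1..N}. digit b j x = 1} \<subseteq> {1..n}" for N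
  proof
    fix j assume j: "j \<in> {j \<in> {1..N}. digit b j x = 1}"
    show "j \<in> {1..n}"
    proof (rule ccontr)
      assume "j \<notin> {1..n}"
      then have "j = Suc (n + (j - Suc n))" using j by auto
      then show False using digit[of "j - Suc n"] j by simp
    qed
  qed
  then have "card {j \<in> {1..N}. digit b j x = 1} \<le> n" for N
    using card_mono[of "{1..n}"] by (metis card_atLeastAtMost diff_Suc_1 finite_atLeastAtMost)
  then have "real (card {j \<in> {1..N}. digit b j x = 1}) / real N \<le> real n / real N" for N
    by (intro divide_right_mono) auto
  moreover have one: "1 \<in> digit_set b" using expansion_base_gt_1[OF b] by (simp add: digit_set_iff[OF b])
  then have "(\<lambda>N. real (card {j \<in> {1..N}. digit b j x = 1}) / real N) \<longlonglongrightarrow> p 1"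
    using x by (auto simp: freq_set_def)
  moreover have "(\<lambda>N. real n / real N) \<longlonglongrightarrow> 0" by (rule lim_const_over_n)
  ultimately have "p 1 \<le> 0" by (intro LIMSEQ_le) auto
  then show False using p one unfolding stochastic_def by fastforce
qed

text \<open>
  The first n digits of x are followed by m zeros and then by the digits of y. If b^(-m) is smaller
  than the n-th iterate of x, this is the expansion of a point, because the new tail is smaller than
  the tail of x; that iterate is positive for quasinormal x.
\<close>
lemma freq_set_dense:
  assumes b: "expansion_base b" and x: "x \<in> quasinormal b" and y: "y \<in> freq_set b q" and e: "0 < e"
  obtains z where "z \<in> freq_set b q" "dist z x < e"
proof -
  note b1 = expansion_base_gt_1[OF b]
  obtain p where p: "stochastic b p" "x \<in> freq_set b p" using x unfolding quasinormal_def by blast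
  have x01: "x \<in> {0..<1}" and y01: "y \<in> {0..<1}" using p y by (auto simp: freq_set_def)
  have small: "\<exists>n. 1 / b ^ n < d" if "0 < d" for d
    using real_arch_pow_inv[OF that, of "1 / b"] b1 by (auto simp: power_divide)
  obtain n where n: "1 / b ^ n < e" using small e by blast
  let ?t = "(T_map b ^^ n) x"
  have t: "0 < ?t" "?t < 1" using quasinormal_T_iter_pos[OF b p] T_iter_in[OF x01, of n b] by auto
  obtain m where m: "1 / b ^ m < ?t" using small t by blast
  define v where "v = y / b ^ m"
  have "v \<le> 1 / b ^ m" unfolding v_def using y01 b1 by (intro divide_right_mono) auto
  then have v: "0 \<le> v" "v \<le> ?t" using m y01 b1 by (auto simp: v_def)
  define z where "z = x - (?t - v) / b ^ n"
  have z: "z \<in> {0..<1}" "(T_map b ^^ n) z = v"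
    using T_iter_perturb[OF b x01 v] unfolding z_def by auto
  have "(T_map b ^^ (m + n)) z = (T_map b ^^ m) v" using z by (simp add: funpow_add)
  also have "\<dots> = y" using T_iter_divide_power[OF b1, of y m m] y01 by (simp add: v_def)
  finally have "z \<in> freq_set b q" using freq_set_T_iter[OF z(1)] y by metis
  moreover have "dist z x < e"
  proof -
    have "(?t - v) / b ^ n \<le> 1 / b ^ n" using t v b1 by (intro divide_right_mono) auto
    moreover have "0 \<le> (?t - v) / b ^ n" using v b1 by simp
    ultimately show ?thesis using n by (simp add: z_def dist_real_def)
  qed
  ultimately show ?thesis using that by blast
qed

text \<open>
  The map y \<mapsto> i / b + y / b^(L + 1) puts the block consisting of i and L zeros in front of the expansion
  of y.
\<close>
lemma sum_digits_block:
  fixes g :: "nat \<Rightarrow> real"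
  assumes b: "expansion_base b" and i: "real i / b + 1 / b ^ Suc L \<le> 1" and y: "y \<in> {0..<1}"
  defines "z \<equiv> real i / b + y / b ^ Suc L"
  shows "z \<in> {0..<1}" "(T_map b ^^ Suc L) z = y"
    "(\<Sum>k=1..Suc L. g (digit b k z)) = g i + real L * g 0"
proof -
  note b1 = expansion_base_gt_1[OF b]
  have "y / b ^ Suc L < 1 / b ^ Suc L" using y b1 by (intro divide_strict_right_mono) auto
  then show z: "z \<in> {0..<1}" using i y b1 unfolding z_def by auto
  have yL: "0 \<le> y / b ^ L" "y / b ^ L < 1"
    using y b1 divide_power_less_1[OF b1, of y L] by auto
  have bz: "b * z = real i + y / b ^ L" using b1 by (simp add: z_def algebra_simps)
  have T1: "T_map b z = y / b ^ L" "digit b 1 z = i"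
    using T_map_digit_add[OF yL bz] by (auto simp: digit_def)
  have T: "(T_map b ^^ Suc k) z = y / b ^ (L - k)" if "k \<le> L" for k
    using T_iter_divide_power[OF b1, of y k L] that y T1 by (simp add: funpow_swap1)
  show "(T_map b ^^ Suc L) z = y" using T[of L] by (simp del: funpow.simps)
  have "digit b k z = 0" if "k \<in> {2..Suc L}" for k
  proof -
    define j where "j = k - 2"
    have j: "k = Suc (Suc j)" using that by (simp add: j_def, arith)
    have "b * (T_map b ^^ Suc j) z = y / b ^ (L - Suc j)"
      using T[of j] that j b1 by (simp add: Suc_diff_Suc[symmetric] del: funpow.simps)
    moreover have "0 \<le> y / b ^ (L - Suc j)" "y / b ^ (L - Suc j) < 1"
      using y b1 divide_power_less_1[OF b1, of y "L - Suc j"] by auto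
    ultimately show ?thesis by (simp add: digit_def j floor_eq_iff del: funpow.simps)
  qed
  then have "(\<Sum>k=2..Suc L. g (digit b k z)) = real L * g 0" by simp
  moreover have "(\<Sum>k=1..Suc L. g (digit b k z)) = g (digit b 1 z) + (\<Sum>k=2..Suc L. g (digit b k z))"
    by (subst sum.atLeast_Suc_atMost) (simp_all only: numeral_2_eq_2 One_nat_def le_add1 Suc_le_mono le0)
  ultimately show "(\<Sum>k=1..Suc L. g (digit b k z)) = g i + real L * g 0"
    using T1 by simp
qed

text \<open>
  The composition of the block maps along the word u is a continuous map of [0,1] into itself; a fixed
  point has the periodic expansion that repeats the blocks of u.
\<close>
lemma periodic_block_point:
  assumes b: "expansion_base b" and L: "\<And>i. i \<in> digit_set b \<Longrightarrow> real i / b + 1 / b ^ Suc L < 1"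
    and u: "u \<noteq> []" "set u \<subseteq> digit_set b"
  obtains x where "x \<in> {0..<1}" "(T_map b ^^ (Suc L * length u)) x = x"
    "\<And>g :: nat \<Rightarrow> real. (\<Sum>k=1..Suc L * length u. g (digit b k x)) = (\<Sum>i\<leftarrow>u. g i + real L * g 0)"
proof -
  note b1 = expansion_base_gt_1[OF b]
  define \<phi> where "\<phi> i y = real i / b + y / b ^ Suc L" for i y
  let ?F = "\<lambda>u y. foldr \<phi> u y"
  have \<phi>: "0 \<le> \<phi> i y" "\<phi> i y < 1" if "i \<in> digit_set b" "0 \<le> y" "y \<le> 1" for i y
  proof -
    have "y / b ^ Suc L \<le> 1 / b ^ Suc L" using that b1 by (intro divide_right_mono) auto
    then show "0 \<le> \<phi> i y" "\<phi> i y < 1" using L[OF that(1)] that b1 by (auto simp: \<phi>_def)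
  qed
  have F_le: "0 \<le> ?F w y \<and> ?F w y \<le> 1" if "set w \<subseteq> digit_set b" "0 \<le> y" "y \<le> 1" for w y
    using that by (induction w) (auto intro!: \<phi> less_imp_le[OF \<phi>(2)])
  have F_less: "?F u y < 1" if "0 \<le> y" "y \<le> 1" for y
    using u F_le[of "tl u" y] that by (cases u) (auto intro!: \<phi>)
  have cont: "continuous_on S (?F w)" for S w
  proof (induction w)
    case (Cons i w)
    have "continuous_on T (\<phi> i)" for T
      unfolding \<phi>_def using b1 by (intro continuous_intros) auto
    then have "continuous_on S (\<phi> i \<circ> ?F w)" using Cons by (intro continuous_on_compose)
    then show ?case by simp
  qed (simp add: id_def)
  have "\<exists>x\<ge>0. x \<le> 1 \<and> ?F u x - x = 0"
    by (rule IVT2') (use F_le[OF u(2)] in \<open>auto intro!: continuous_intros cont\<close>)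
  then obtain x where x: "0 \<le> x" "x \<le> 1" "?F u x = x" by auto
  have x1: "x \<in> {0..<1}" using F_less x by force
  have block: "?F w y \<in> {0..<1} \<and> (T_map b ^^ (Suc L * length w)) (?F w y) = y \<and>
    (\<Sum>k=1..Suc L * length w. g (digit b k (?F w y))) = (\<Sum>i\<leftarrow>w. g i + real L * g 0)"
    if w: "set w \<subseteq> digit_set b" and y: "y \<in> {0..<1}" for w y and g :: "nat \<Rightarrow> real"
    using w
  proof (induction w)
    case (Cons i w)
    let ?y = "?F w y" and ?n = "Suc L * length w"
    have y': "?y \<in> {0..<1}" and IH: "(T_map b ^^ ?n) ?y = y"
      "(\<Sum>k=1..?n. g (digit b k ?y)) = (\<Sum>i\<leftarrow>w. g i + real L * g 0)" using Cons by auto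
    have "real i / b + 1 / b ^ Suc L \<le> 1" using L[of i] Cons.prems by auto
    note blk = sum_digits_block[OF b this y', folded \<phi>_def]
    have "(\<Sum>k=1..?n + Suc L. g (digit b k (\<phi> i ?y)))
      = (\<Sum>k=1..Suc L. g (digit b k (\<phi> i ?y))) + (\<Sum>k=1..?n. g (digit b (k + Suc L) (\<phi> i ?y)))"
      by (induction ("?n")) (auto simp: add.commute)
    also have "(\<Sum>k=1..?n. g (digit b (k + Suc L) (\<phi> i ?y))) = (\<Sum>k=1..?n. g (digit b k ?y))"
      using digit_shift[of _ b "Suc L" "\<phi> i ?y"] blk(2) by (intro sum.cong) auto
    finally have "(\<Sum>k=1..?n + Suc L. g (digit b k (\<phi> i ?y))) = (\<Sum>i\<leftarrow>i # w. g i + real L * g 0)"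
      using blk(3)[of g] IH(2) by simp
    moreover have "(T_map b ^^ (?n + Suc L)) (\<phi> i ?y) = y"
      using blk(2) IH(1) by (simp only: funpow_add o_apply)
    moreover have "Suc L * length (i # w) = ?n + Suc L" by simp
    ultimately show ?case using blk(1) by (simp only: foldr.simps o_apply)
  qed (use y in simp)
  show ?thesis
    using that[OF x1] block[OF u(2) x1] unfolding x(3) by blast
qed

section \<open>Pressure and dimension\<close>

lemma prod_tendsto_0_of_mean_ln:
  fixes f :: "nat \<Rightarrow> real"
  assumes pos: "\<And>k. 1 \<le> k \<Longrightarrow> 0 < f k" and "l < 0"
    and lim: "(\<lambda>n. (\<Sum>k=1..n. ln (f k)) / real n) \<longlonglongrightarrow> l"
  shows "(\<lambda>n. \<Prod>k=1..n. f k) \<longlonglongrightarrow> 0"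
proof (rule Lim_null_comparison)
  have "l < l / 2" using \<open>l < 0\<close> by simp
  with lim have "\<forall>\<^sub>F n in sequentially. (\<Sum>k=1..n. ln (f k)) / real n < l / 2"
    by (rule order_tendstoD)
  then show "\<forall>\<^sub>F n in sequentially. norm (\<Prod>k=1..n. f k) \<le> exp (l / 2) ^ n"
    using eventually_gt_at_top[of 0]
  proof eventually_elim
    case (elim n)
    have "(\<Prod>k=1..n. f k) = exp (\<Sum>k=1..n. ln (f k))"
      using pos by (subst exp_sum) (auto intro!: prod.cong)
    also have "\<dots> \<le> exp (real n * (l / 2))" using elim by (simp add: field_simps)
    also have "\<dots> = exp (l / 2) ^ n" by (rule exp_of_nat_mult)
    finally have "(\<Prod>k=1..n. f k) \<le> exp (l / 2) ^ n" .
    moreover have "0 \<le> (\<Prod>k=1..n. f k)" using pos by (intro prod_nonneg) (auto intro: less_imp_le)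
    ultimately show ?case by simp
  qed
  show "(\<lambda>n. exp (l / 2) ^ n) \<longlonglongrightarrow> 0"
    using \<open>l < 0\<close> by (intro LIMSEQ_realpow_zero) auto
qed

lemma prod_bounded_below_of_mean_ln:
  fixes f :: "nat \<Rightarrow> real"
  assumes pos: "\<And>k. 1 \<le> k \<Longrightarrow> 0 < f k" and "0 < l"
    and lim: "(\<lambda>n. (\<Sum>k=1..n. ln (f k)) / real n) \<longlonglongrightarrow> l"
  obtains m where "0 < m" "\<And>n. m \<le> (\<Prod>k=1..n. f k)"
proof -
  have "\<forall>\<^sub>F n in sequentially. 0 < (\<Sum>k=1..n. ln (f k)) / real n"
    using lim \<open>0 < l\<close> by (rule order_tendstoD)
  then obtain n0 where n0: "\<And>n. n0 \<le> n \<Longrightarrow> 0 < (\<Sum>k=1..n. ln (f k)) / real n"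
    unfolding eventually_sequentially by blast
  let ?A = "insert 1 ((\<lambda>n. \<Prod>k=1..n. f k) ` {..n0})"
  have "Min ?A \<le> (\<Prod>k=1..n. f k)" for n
  proof (cases "n \<le> n0")
    case True
    then show ?thesis by (intro Min_le) auto
  next
    case False
    then have "0 < (\<Sum>k=1..n. ln (f k))" using n0[of n] by (simp add: zero_less_divide_iff)
    then have "1 \<le> exp (\<Sum>k=1..n. ln (f k))" by simp
    also have "\<dots> = (\<Prod>k=1..n. f k)"
      using pos by (subst exp_sum) (auto intro!: prod.cong)
    finally show ?thesis by (intro order_trans[OF Min_le[of ?A 1]]) auto
  qed
  moreover have "0 < Min ?A" using pos by (subst Min_gr_iff) (auto intro!: prod_pos)
  ultimately show ?thesis using that by blast
qed

text \<open>
  The uniform bound s < 1 makes the pressure strictly decreasing and the diameters of the construction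
  sets tend to 0.
\<close>
locale coefficient_family =
  fixes b :: real and \<gamma> :: "nat \<Rightarrow> nat \<Rightarrow> real" and s :: real
  assumes base: "expansion_base b"
    and coeff_pos: "\<And>i j. i \<in> digit_set b \<Longrightarrow> 0 < \<gamma> i j"
    and coeff_summable: "\<And>i. i \<in> digit_set b \<Longrightarrow> summable (\<gamma> i)"
    and coeff_le: "\<And>i j. i \<in> digit_set b \<Longrightarrow> \<gamma> i j \<le> s" and s_less_1: "s < 1"
begin

lemma zero_in_digit_set: "0 \<in> digit_set b"
  using expansion_base_gt_1[OF base] by (simp add: digit_set_iff[OF base])

lemma s_pos: "0 < s"
  using coeff_pos[OF zero_in_digit_set, of 0] coeff_le[OF zero_in_digit_set, of 0] by simp

lemma coeff_less_1: "i \<in> digit_set b \<Longrightarrow> \<gamma> i j < 1"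
  using coeff_le[of i j] s_less_1 by simp

lemma Inf_le_theta:
  "i \<in> digit_set b \<Longrightarrow> Inf {t. 0 < t \<and> summable (\<lambda>j. \<gamma> i j powr t)} \<le> theta b \<gamma>"
  unfolding theta_def using finite_digit_set by (intro Max_ge) auto

lemma one_summable: "i \<in> digit_set b \<Longrightarrow> 1 \<in> {t. 0 < t \<and> summable (\<lambda>j. \<gamma> i j powr t)}"
proof -
  assume i: "i \<in> digit_set b"
  have "\<gamma> i j powr 1 = \<gamma> i j" for j using coeff_pos[OF i, of j] by simp
  then show ?thesis using coeff_summable[OF i] by (simp only: mem_Collect_eq zero_less_one simp_thms)
qed

lemma theta_nonneg: "0 \<le> theta b \<gamma>"
proof -
  have "0 \<le> Inf {t. 0 < t \<and> summable (\<lambda>j. \<gamma> 0 j powr t)}"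
  proof (rule cInf_greatest)
    show "{t. 0 < t \<and> summable (\<lambda>j. \<gamma> 0 j powr t)} \<noteq> {}"
      using one_summable[OF zero_in_digit_set] by blast
  qed auto
  then show ?thesis using Inf_le_theta[OF zero_in_digit_set] by simp
qed

lemma summable_powr:
  assumes i: "i \<in> digit_set b" and t: "theta b \<gamma> < t"
  shows "summable (\<lambda>j. \<gamma> i j powr t)"
proof -
  have "Inf {t. 0 < t \<and> summable (\<lambda>j. \<gamma> i j powr t)} < t"
    using Inf_le_theta[OF i] t by simp
  then obtain t' where t': "0 < t'" "summable (\<lambda>j. \<gamma> i j powr t')" "t' < t"
    using cInf_lessD[of "{t. 0 < t \<and> summable (\<lambda>j. \<gamma> i j powr t)}" t] one_summable[OF i] by blast
  from t'(2) show ?thesis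
  proof (rule summable_comparison_test'[where N = 0])
    fix j show "norm (\<gamma> i j powr t) \<le> \<gamma> i j powr t'"
      using t' coeff_pos[OF i, of j] coeff_less_1[OF i, of j] by (simp add: powr_mono')
  qed
qed

lemma powr_sum_pos:
  assumes i: "i \<in> digit_set b" and t: "theta b \<gamma> < t"
  shows "0 < (\<Sum>j. \<gamma> i j powr t)"
proof (rule suminf_pos[OF summable_powr[OF i t]])
  fix j show "0 < \<gamma> i j powr t" using coeff_pos[OF i, of j] by simp
qed

lemma powr_sum_decay:
  assumes i: "i \<in> digit_set b" and t: "theta b \<gamma> < t" "t \<le> t'"
  shows "(\<Sum>j. \<gamma> i j powr t') \<le> s powr (t' - t) * (\<Sum>j. \<gamma> i j powr t)"
proof -
  have "\<gamma> i j powr t' \<le> s powr (t' - t) * \<gamma> i j powr t" for j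
  proof -
    have "\<gamma> i j powr t' = \<gamma> i j powr (t' - t) * \<gamma> i j powr t" by (simp add: powr_add[symmetric])
    also have "\<dots> \<le> s powr (t' - t) * \<gamma> i j powr t"
      using coeff_pos[OF i, of j] coeff_le[OF i, of j] t by (intro mult_right_mono powr_mono2) auto
    finally show ?thesis .
  qed
  then have "(\<Sum>j. \<gamma> i j powr t') \<le> (\<Sum>j. s powr (t' - t) * \<gamma> i j powr t)"
    using t by (intro suminf_le summable_mult summable_powr[OF i]) auto
  also have "\<dots> = s powr (t' - t) * (\<Sum>j. \<gamma> i j powr t)"
    using summable_powr[OF i t(1)] by (rule suminf_mult)
  finally show ?thesis .
qed

text \<open>
  Raising the exponent by d multiplies each power sum by at most s^d. This single estimate makes the
  pressure strictly decreasing and eventually nonpositive.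
\<close>
lemma pressure_decay:
  assumes p: "stochastic b p" and t: "theta b \<gamma> < t" "t \<le> t'"
  shows "pressure b \<gamma> p t' \<le> pressure b \<gamma> p t + (t' - t) * ln s"
proof -
  have "p i * ln (\<Sum>j. \<gamma> i j powr t') \<le> p i * ln (\<Sum>j. \<gamma> i j powr t) + p i * ((t' - t) * ln s)"
    if i: "i \<in> digit_set b" for i
  proof -
    have "ln (\<Sum>j. \<gamma> i j powr t') \<le> ln (s powr (t' - t) * (\<Sum>j. \<gamma> i j powr t))"
      using powr_sum_decay[OF i t] powr_sum_pos[OF i] t s_pos
      by (subst ln_le_cancel_iff) auto
    also have "\<dots> = ln (\<Sum>j. \<gamma> i j powr t) + (t' - t) * ln s"
      using powr_sum_pos[OF i t(1)] s_pos by (simp add: ln_mult)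
    finally show ?thesis
      using p i unfolding stochastic_def distrib_left[symmetric] by (intro mult_left_mono) (auto intro: less_imp_le)
  qed
  then have "pressure b \<gamma> p t' \<le> (\<Sum>i\<in>digit_set b. p i * ln (\<Sum>j. \<gamma> i j powr t) + p i * ((t' - t) * ln s))"
    unfolding pressure_def by (rule sum_mono)
  also have "\<dots> = pressure b \<gamma> p t + (\<Sum>i\<in>digit_set b. p i) * ((t' - t) * ln s)"
    by (simp add: pressure_def sum.distrib sum_distrib_right)
  finally show ?thesis using p by (simp add: stochastic_def)
qed

text \<open>
  The series at the left end point dominates the series on the whole half-line.
\<close>
lemma continuous_on_powr_sum:
  assumes i: "i \<in> digit_set b" and t: "theta b \<gamma> < t"
  shows "continuous_on {t..} (\<lambda>u. \<Sum>j. \<gamma> i j powr u)"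
proof (rule uniform_limit_theorem)
  show "uniform_limit {t..} (\<lambda>n u. \<Sum>j<n. \<gamma> i j powr u) (\<lambda>u. \<Sum>j. \<gamma> i j powr u) sequentially"
  proof (rule Weierstrass_m_test[where M = "\<lambda>j. \<gamma> i j powr t"])
    fix j u assume "u \<in> {t..}"
    then show "norm (\<gamma> i j powr u) \<le> \<gamma> i j powr t"
      using coeff_pos[OF i, of j] coeff_less_1[OF i, of j] by (simp add: powr_mono')
  qed (rule summable_powr[OF i t])
  have "\<gamma> i j \<noteq> 0" for j using coeff_pos[OF i, of j] by simp
  then show "\<forall>\<^sub>F n in sequentially. continuous_on {t..} (\<lambda>u. \<Sum>j<n. \<gamma> i j powr u)"
    by (intro always_eventually allI continuous_intros) auto
qed simp

lemma pressure_zero_exists: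
  assumes p: "stochastic b p" and u: "theta b \<gamma> < u" "0 < pressure b \<gamma> p u"
  obtains h where "theta b \<gamma> < h" "pressure b \<gamma> p h = 0"
proof -
  have ln_s: "ln s < 0" using s_pos s_less_1 by simp
  \<comment> \<open>The line through the value at u with slope ln s reaches 0 at v.\<close>
  define v where "v = u + pressure b \<gamma> p u / - ln s"
  have uv: "u \<le> v" unfolding v_def using u ln_s by (simp add: divide_nonneg_neg)
  have "pressure b \<gamma> p v \<le> pressure b \<gamma> p u + (v - u) * ln s" using pressure_decay[OF p u(1) uv] .
  also have "\<dots> = 0" using ln_s by (simp add: v_def)
  finally have v: "pressure b \<gamma> p v \<le> 0" .
  have "continuous_on {u..} (pressure b \<gamma> p)"
  proof -
    have "continuous_on {u..} (\<lambda>t. \<Sum>i\<in>digit_set b. p i * ln (\<Sum>j. \<gamma> i j powr t))"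
    proof (intro continuous_on_sum continuous_on_mult continuous_on_const continuous_on_ln)
      fix i assume i: "i \<in> digit_set b"
      then show "continuous_on {u..} (\<lambda>t. \<Sum>j. \<gamma> i j powr t)" using u by (intro continuous_on_powr_sum)
      show "\<forall>t\<in>{u..}. (\<Sum>j. \<gamma> i j powr t) \<noteq> 0"
        using powr_sum_pos[OF i] u by (metis atLeast_iff less_irrefl less_le_trans)
    qed
    then show ?thesis by (simp add: pressure_def[abs_def])
  qed
  then have "continuous_on {u..v} (pressure b \<gamma> p)" by (rule continuous_on_subset) auto
  then have "\<exists>h\<ge>u. h \<le> v \<and> pressure b \<gamma> p h = 0"
    using v u uv by (intro IVT2') auto
  then show ?thesis using that u(1) by (meson less_le_trans)
qed

lemma pressure_sign:
  assumes p: "stochastic b p" and h: "theta b \<gamma> < h" "pressure b \<gamma> p h = 0"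
  shows "h < t \<Longrightarrow> pressure b \<gamma> p t < 0"
    and "theta b \<gamma> < t \<Longrightarrow> t < h \<Longrightarrow> 0 < pressure b \<gamma> p t"
proof -
  have ln_s: "ln s < 0" using s_pos s_less_1 by simp
  show "pressure b \<gamma> p t < 0" if "h < t"
  proof -
    have "(t - h) * ln s < 0" using that ln_s by (simp add: mult_pos_neg)
    then show ?thesis using pressure_decay[OF p h(1), of t] that h(2) by simp
  qed
  show "0 < pressure b \<gamma> p t" if "theta b \<gamma> < t" "t < h"
  proof -
    have "(h - t) * ln s < 0" using that ln_s by (simp add: mult_pos_neg)
    then show ?thesis using pressure_decay[OF p that(1), of h] that h(2) by simp
  qed
qed

lemma finite_pressure_pos:
  assumes t: "theta b \<gamma> < t" "0 < pressure b \<gamma> p t"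
  obtains N where "0 < N" "0 < (\<Sum>i\<in>digit_set b. p i * ln (\<Sum>j<N. \<gamma> i j powr t))"
proof -
  have "(\<lambda>N. \<Sum>i\<in>digit_set b. p i * ln (\<Sum>j<N. \<gamma> i j powr t)) \<longlonglongrightarrow> pressure b \<gamma> p t"
    unfolding pressure_def
    using powr_sum_pos[OF _ t(1)] summable_LIMSEQ[OF summable_powr[OF _ t(1)]]
    by (intro tendsto_sum tendsto_mult tendsto_const tendsto_ln) (auto simp: less_imp_neq[THEN not_sym])
  then have "\<forall>\<^sub>F N in sequentially. 0 < (\<Sum>i\<in>digit_set b. p i * ln (\<Sum>j<N. \<gamma> i j powr t))"
    using t(2) by (rule order_tendstoD)
  then have "\<forall>\<^sub>F N in sequentially. 0 < N \<and> 0 < (\<Sum>i\<in>digit_set b. p i * ln (\<Sum>j<N. \<gamma> i j powr t))"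
    using eventually_gt_at_top[of 0] by eventually_elim auto
  then show ?thesis using that by (auto simp: eventually_sequentially)
qed

text \<open>
  Below the zero the pressure is positive, even for a truncation of the vectors, and the products
  of the level sums stay bounded away from 0; above the zero the pressure is negative and the products
  tend to 0.
\<close>
theorem dimension_eq_pressure_zero:
  fixes J :: "'a::euclidean_space set"
  assumes p: "stochastic b p" and x: "x \<in> freq_set b p"
    and h: "theta b \<gamma> < h" "pressure b \<gamma> p h = 0"
    and J: "compact J" "interior J \<noteq> {}" "diameter J = 1"
    and K: "moran_collection J (\<lambda>k j. \<gamma> (digit b k x) j) K"
  shows "hausdorff_dim (moran_fractal K) = h"
proof -
  have x01: "x \<in> {0..<1}" using x by (simp add: freq_set_def)
  note digit = digit_in_digit_set[OF base x01]
  interpret moran_construction J "\<lambda>k j. \<gamma> (digit b k x) j" K s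
    by unfold_locales (use J K digit coeff_pos coeff_le s_less_1 in auto)
  have upper: "hausdorff_measure t (moran_fractal K) = 0" if t: "h < t" for t
  proof (rule hausdorff_measure_eq_0)
    have \<theta>: "theta b \<gamma> < t" using h t by simp
    then show "0 < t" using theta_nonneg by simp
    show "summable (\<lambda>j. \<gamma> (digit b k x) j powr t)" if "1 \<le> k" for k
      using summable_powr[OF digit \<theta>] that .
    show "(\<lambda>n. \<Prod>k=1..n. \<Sum>j. \<gamma> (digit b k x) j powr t) \<longlonglongrightarrow> 0"
    proof (rule prod_tendsto_0_of_mean_ln)
      show "0 < (\<Sum>j. \<gamma> (digit b k x) j powr t)" if "1 \<le> k" for k
        using powr_sum_pos[OF digit \<theta>] that .
      show "pressure b \<gamma> p t < 0" using pressure_sign(1)[OF p h t] .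
      show "(\<lambda>n. (\<Sum>k=1..n. ln (\<Sum>j. \<gamma> (digit b k x) j powr t)) / real n) \<longlonglongrightarrow> pressure b \<gamma> p t"
        unfolding pressure_def using freq_set_mean[OF base x] .
    qed
  qed
  have lower: "0 < hausdorff_measure u (moran_fractal K)" if t: "theta b \<gamma> < t" "t < h" and u: "0 < u" "u \<le> t" for t u
  proof -
    obtain N where N: "0 < N" "0 < (\<Sum>i\<in>digit_set b. p i * ln (\<Sum>j<N. \<gamma> i j powr t))"
      using finite_pressure_pos[OF t(1) pressure_sign(2)[OF p h t]] .
    have "0 < (\<Sum>j<N. \<gamma> (digit b k x) j powr t)" if "1 \<le> k" for k
    proof -
      have "\<gamma> (digit b k x) j \<noteq> 0" for j using coeff_pos[OF digit[OF that], of j] by simp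
      then show ?thesis using N by (intro sum_pos) auto
    qed
    then obtain m where m: "0 < m" "\<And>n. m \<le> (\<Prod>k=1..n. \<Sum>j<N. \<gamma> (digit b k x) j powr t)"
      using prod_bounded_below_of_mean_ln[OF _ N(2) freq_set_mean[OF base x]] by metis
    let ?A = "(\<lambda>(i, j). \<gamma> i j) ` (digit_set b \<times> {..<N})"
    have A: "finite ?A" "?A \<noteq> {}" using finite_digit_set zero_in_digit_set N by auto
    show ?thesis
    proof (rule hausdorff_measure_pos[OF _ u _ _ m])
      show "0 < t" using t theta_nonneg by simp
      show "0 < Min ?A" using A coeff_pos by auto
      show "Min ?A \<le> \<gamma> (digit b k x) j" if "1 \<le> k" "j < N" for k j
        using A digit[OF that(1)] that by (intro Min_le) auto
    qed
  qed
  let ?Z = "{t. 0 < t \<and> hausdorff_measure t (moran_fractal K) = 0}"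
  have Z: "t \<in> ?Z" if "h < t" for t using upper[OF that] that h theta_nonneg by simp
  have bdd: "bdd_below ?Z" by (rule bdd_belowI[of _ 0]) auto
  show ?thesis unfolding hausdorff_dim_def
  proof (rule antisym)
    show "Inf ?Z \<le> h"
    proof (rule dense_ge)
      fix t assume "h < t"
      then show "Inf ?Z \<le> t" using Z bdd by (intro cInf_lower)
    qed
    show "h \<le> Inf ?Z"
    proof (rule cInf_greatest)
      show "?Z \<noteq> {}" using Z[of "h + 1"] by auto
      fix u assume u: "u \<in> ?Z"
      show "h \<le> u"
      proof (rule ccontr)
        assume "\<not> h \<le> u"
        then obtain t where "max u (theta b \<gamma>) < t" "t < h" using dense[of "max u (theta b \<gamma>)" h] h by auto
        then show False using lower[of t u] u by auto
      qed
    qed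
  qed
qed

section \<open>Varying the frequencies\<close>

text \<open>
  A periodic point whose digits, separated by L zeros, run through u is quasinormal as soon as u contains
  every digit.
\<close>
lemma quasinormal_point_of_word:
  assumes L: "\<And>i. i \<in> digit_set b \<Longrightarrow> real i / b + 1 / b ^ Suc L < 1"
    and u: "set u = digit_set b"
  obtains p x where "stochastic b p" "x \<in> freq_set b p"
    "\<And>g. (\<Sum>i\<in>digit_set b. p i * g i) = (\<Sum>i\<leftarrow>u. g i + real L * g 0) / real (Suc L * length u)"
proof -
  have "u \<noteq> []" using zero_in_digit_set u by auto
  then obtain x where x: "x \<in> {0..<1}" "(T_map b ^^ (Suc L * length u)) x = x"
    "\<And>g :: nat \<Rightarrow> real. (\<Sum>k=1..Suc L * length u. g (digit b k x)) = (\<Sum>i\<leftarrow>u. g i + real L * g 0)"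
    using periodic_block_point[OF base L] u by blast
  let ?P = "Suc L * length u"
  have P: "0 < ?P" using \<open>u \<noteq> []\<close> by simp
  define p where "p i = (\<Sum>k=1..?P. of_bool (digit b k x = i)) / real ?P" for i
  have "digit b (k + ?P) x = digit b k x" if "1 \<le> k" for k
    using digit_shift[OF that, of b ?P x] x(2) by simp
  then have mean: "(\<lambda>n. (\<Sum>k=1..n. g (digit b k x)) / real n) \<longlonglongrightarrow> (\<Sum>k=1..?P. g (digit b k x)) / real ?P" for g
    using mean_tendsto_periodic[OF P, of "\<lambda>k. g (digit b k x)"] by simp
  have freq: "x \<in> freq_set b p"
    unfolding freq_set_iff_mean p_def using x(1) mean[of "\<lambda>d. of_bool (d = _)"] by blast
  have sum: "(\<Sum>i\<in>digit_set b. p i * g i) = (\<Sum>i\<leftarrow>u. g i + real L * g 0) / real ?P" for g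
    using LIMSEQ_unique[OF freq_set_mean[OF base freq, of g] mean[of g]] unfolding x(3) .
  have "stochastic b p"
    unfolding stochastic_def
  proof (intro conjI ballI)
    have "(\<Sum>i\<in>digit_set b. p i) = (\<Sum>i\<leftarrow>u. 1 + real L * 1) / real ?P"
      using sum[of "\<lambda>_. 1"] by (simp only: mult_1_right)
    also have "(\<Sum>i\<leftarrow>u. 1 + real L * 1) = real ?P" by (simp add: sum_list_triv algebra_simps)
    also have "real ?P / real ?P = 1" using P by (metis divide_self less_irrefl of_nat_0_eq_iff)
    finally show "(\<Sum>i\<in>digit_set b. p i) = 1" .
    fix i assume "i \<in> digit_set b"
    then obtain v w where u_split: "u = v @ i # w" using u by (metis split_list)
    let ?f = "\<lambda>j. of_bool (j = i) + real L * of_bool (0 = i)"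
    have "0 \<le> sum_list (map ?f w)" for w by (rule sum_list_nonneg) auto
    from this[of v] this[of w] have "0 < (\<Sum>j\<leftarrow>u. ?f j)" unfolding u_split by auto
    also have "\<dots> = (\<Sum>k=1..?P. of_bool (digit b k x = i))"
      by (rule x(3)[of "\<lambda>d. of_bool (d = i)", symmetric])
    finally show "0 < p i" unfolding p_def using P by (intro divide_pos_pos) (simp_all only: of_nat_0_less_iff)
  qed
  then show ?thesis using that freq sum by blast
qed

text \<open>
  For every word u that contains all digits, the numbers G i + L G 0 with G i = log S_i(t) have sum 0
  along u. Comparing u with i # u shows that each of them is 0. For i = 0 this means G 0 = 0, so all
  G i vanish. The separation is possible because every digit is smaller than b, so that
  i / b + 1 / b^(L + 1) < 1 for large L.
\<close>
lemma degenerate_if_common_zero: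
  assumes t: "theta b \<gamma> < t"
    and zero: "\<And>p x. stochastic b p \<Longrightarrow> x \<in> freq_set b p \<Longrightarrow> pressure b \<gamma> p t = 0"
  shows "degenerate b \<gamma>"
proof -
  note b1 = expansion_base_gt_1[OF base]
  have "\<forall>\<^sub>F L in sequentially. real i / b + 1 / b ^ Suc L < 1" if i: "i \<in> digit_set b" for i
  proof -
    have "(\<lambda>L. (1 / b) ^ L) \<longlonglongrightarrow> 0" using b1 by (intro LIMSEQ_realpow_zero) auto
    then have "(\<lambda>L. real i / b + (1 / b) ^ Suc L) \<longlonglongrightarrow> real i / b + 0"
      by (intro tendsto_add tendsto_const LIMSEQ_Suc)
    moreover have "real i / b + 0 < 1" using i b1 by (simp add: digit_set_iff[OF base])
    ultimately have "\<forall>\<^sub>F L in sequentially. real i / b + (1 / b) ^ Suc L < 1" by (rule order_tendstoD)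
    then show ?thesis by (simp add: power_divide)
  qed
  then have "\<forall>\<^sub>F L in sequentially. \<forall>i\<in>digit_set b. real i / b + 1 / b ^ Suc L < 1"
    by (simp add: eventually_ball_finite finite_digit_set)
  then obtain L where L: "\<And>i. i \<in> digit_set b \<Longrightarrow> real i / b + 1 / b ^ Suc L < 1"
    by (auto simp: eventually_sequentially)
  define G where "G i = ln (\<Sum>j. \<gamma> i j powr t)" for i
  have G: "(\<Sum>i\<leftarrow>u. G i + real L * G 0) = 0" if u: "set u = digit_set b" for u
  proof -
    obtain p x where p: "stochastic b p" "x \<in> freq_set b p"
      "(\<Sum>i\<in>digit_set b. p i * G i) = (\<Sum>i\<leftarrow>u. G i + real L * G 0) / real (Suc L * length u)"
      using quasinormal_point_of_word[OF L u] by metis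
    have "u \<noteq> []" using zero_in_digit_set u by auto
    then have "real (Suc L * length u) \<noteq> 0" unfolding of_nat_eq_0_iff by simp
    moreover have "(\<Sum>i\<in>digit_set b. p i * G i) = 0"
      using zero[OF p(1,2)] by (simp add: pressure_def G_def)
    ultimately show ?thesis using p(3) by (metis divide_eq_0_iff)
  qed
  obtain u where u: "set u = digit_set b" using finite_list[OF finite_digit_set] by blast
  have eq: "G i + real L * G 0 = 0" if "i \<in> digit_set b" for i
  proof -
    have "set (i # u) = digit_set b" using u that by auto
    then show ?thesis using G[of "i # u"] G[OF u] by simp
  qed
  from eq[OF zero_in_digit_set] have "(1 + real L) * G 0 = 0" by (simp add: algebra_simps)
  then have "G 0 = 0" by (simp add: add_nonneg_eq_0_iff)
  then have "G i = 0" if "i \<in> digit_set b" for i using eq[OF that] by simp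
  then have "(\<Sum>j. \<gamma> i j powr t) = 1" if "i \<in> digit_set b" for i
    using exp_ln[OF powr_sum_pos[OF that t]] that unfolding G_def[symmetric] by simp
  then show ?thesis unfolding degenerate_def using t by blast
qed

end

section \<open>The dimension function\<close>

lemma measurable_digit [measurable]: "digit b k \<in> borel \<rightarrow>\<^sub>M count_space UNIV"
proof -
  have T[measurable]: "T_map b \<in> borel_measurable borel"
    unfolding T_map_def[abs_def] frac_def by measurable
  have "T_map b ^^ n \<in> borel_measurable borel" for n
    by (induction n) (auto intro: measurable_comp simp: id_def)
  then have [measurable]: "T_map b ^^ (k - 1) \<in> borel_measurable borel" .
  have [measurable]: "nat \<in> count_space UNIV \<rightarrow>\<^sub>M count_space UNIV" by simp
  show ?thesis unfolding digit_def[abs_def] by measurable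
qed

theorem theorem4p3:
  fixes b :: real
    and \<gamma> :: "nat \<Rightarrow> nat \<Rightarrow> real"
    and J :: "'a::euclidean_space set"
    and K :: "real \<Rightarrow> nat list \<Rightarrow> 'a set"
  assumes base: "expansion_base b"
    and pos: "\<And>i j. i \<in> digit_set b \<Longrightarrow> 0 < \<gamma> i j"
    and summ: "\<And>i. i \<in> digit_set b \<Longrightarrow> summable (\<gamma> i)"
    and sup_less_1: "(SUP (i, j) \<in> digit_set b \<times> UNIV. \<gamma> i j) < 1"
    and diverges: "\<exists>i\<in>digit_set b. \<not> summable (\<lambda>j. \<gamma> i j powr theta b \<gamma>)"
    and pressure_pos: "\<And>p. stochastic b p \<Longrightarrow> \<exists>u>theta b \<gamma>. 0 < pressure b \<gamma> p u"
    and J: "J \<noteq> {}" "compact J" "J = closure (interior J)" "diameter J = 1"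
    and collections: "\<And>x. x \<in> quasinormal b \<Longrightarrow>
      moran_collection J (\<lambda>k j. \<gamma> (digit b k x) j) (K x)"
  shows "dimension_function K \<in> borel_measurable (restrict_space borel (quasinormal b))
    \<and> (\<not> degenerate b \<gamma> \<longrightarrow>
        (\<forall>x\<in>quasinormal b. \<not> continuous (at x within quasinormal b) (dimension_function K)))
    \<and> (\<forall>p. stochastic b p \<longrightarrow> 0 < hausdorff_dim (freq_set b p) \<longrightarrow>
        dimension_function K constant_on freq_set b p)
    \<and> (\<forall>x\<in>quasinormal b. \<forall>U. open U \<longrightarrow> x \<in> U \<longrightarrow>
        dimension_function K ` quasinormal b = dimension_function K ` (U \<inter> quasinormal b))"
proof -
  let ?s = "SUP (i, j) \<in> digit_set b \<times> UNIV. \<gamma> i j"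
  have bdd: "bdd_above ((\<lambda>(i, j). \<gamma> i j) ` (digit_set b \<times> UNIV))"
  proof -
    have "bdd_above (range (\<gamma> i))" if "i \<in> digit_set b" for i
      using summ[OF that] by (metis Bseq_eq_bounded bounded_imp_bdd_above convergent_imp_Bseq convergentI summable_LIMSEQ_zero)
    then have "bdd_above (\<Union>i\<in>digit_set b. range (\<gamma> i))"
      using finite_digit_set by simp
    also have "(\<Union>i\<in>digit_set b. range (\<gamma> i)) = (\<lambda>(i, j). \<gamma> i j) ` (digit_set b \<times> UNIV)" by auto
    finally show ?thesis .
  qed
  interpret coefficient_family b \<gamma> ?s
  proof
    fix i j assume "i \<in> digit_set b"
    then show "\<gamma> i j \<le> ?s" using cSUP_upper[OF _ bdd, of "(i, j)"] by simp
  qed (use base pos summ sup_less_1 in auto)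
  let ?Q = "quasinormal b" and ?H = "dimension_function K" and ?\<theta> = "theta b \<gamma>"
  have int_J: "interior J \<noteq> {}" using J(1,3) by auto
  have in_Q: "x \<in> ?Q" if "stochastic b p" "x \<in> freq_set b p" for x p
    using that unfolding quasinormal_def by blast
  have H: "?\<theta> < ?H x" "pressure b \<gamma> p (?H x) = 0"
    if p: "stochastic b p" and x: "x \<in> freq_set b p" for p x
  proof -
    obtain u where "?\<theta> < u" "0 < pressure b \<gamma> p u" using pressure_pos[OF p] by blast
    then obtain h where h: "?\<theta> < h" "pressure b \<gamma> p h = 0" using pressure_zero_exists[OF p] by metis
    have "?H x = h" unfolding dimension_function_def
      by (rule dimension_eq_pressure_zero[OF p x h J(2) int_J J(4) collections[OF in_Q[OF p x]]])
    then show "?\<theta> < ?H x" "pressure b \<gamma> p (?H x) = 0" using h by auto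
  qed
  have const: "?H x = ?H y" if p: "stochastic b p" and x: "x \<in> freq_set b p" and y: "y \<in> freq_set b p" for p x y
    using pressure_sign(1)[OF p H[OF p x], of "?H y"] pressure_sign(1)[OF p H[OF p y], of "?H x"]
      H(2)[OF p x] H(2)[OF p y] by (cases "?H x" "?H y" rule: linorder_cases) auto
  have meas: "?H \<in> borel_measurable (restrict_space borel ?Q)"
    unfolding borel_measurable_iff_greater
  proof
    fix a
    let ?M = "restrict_space borel ?Q"
    have space: "space ?M = ?Q" by (simp add: space_restrict_space)
    show "{x \<in> space ?M. a < ?H x} \<in> sets ?M"
    proof (cases "?\<theta> < a")
      case False
      have "a < ?H x" if x: "x \<in> ?Q" for x
      proof -
        obtain p where "stochastic b p" "x \<in> freq_set b p" using x unfolding quasinormal_def by blast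
        then show ?thesis using H(1) False by fastforce
      qed
      then have "{x \<in> space ?M. a < ?H x} = space ?M" using space by auto
      then show ?thesis by simp
    next
      case True
      have "\<forall>x\<in>?Q. \<exists>p. stochastic b p \<and> x \<in> freq_set b p" unfolding quasinormal_def by blast
      then obtain p where p: "\<And>x. x \<in> ?Q \<Longrightarrow> stochastic b (p x)" "\<And>x. x \<in> ?Q \<Longrightarrow> x \<in> freq_set b (p x)"
        by metis
      have "a < ?H x \<longleftrightarrow> 0 < pressure b \<gamma> (p x) a" if x: "x \<in> ?Q" for x
        using pressure_sign[OF p(1)[OF x] H[OF p(1)[OF x] p(2)[OF x]], of a]
          H(2)[OF p(1)[OF x] p(2)[OF x]] True
        by (cases a "?H x" rule: linorder_cases) auto
      then have "{x \<in> space ?M. a < ?H x} = {x \<in> space ?M. 0 < pressure b \<gamma> (p x) a}"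
        using space by auto
      moreover have "(\<lambda>x. pressure b \<gamma> (p x) a) \<in> borel_measurable ?M"
      proof (rule borel_measurable_LIMSEQ_real)
        fix x assume "x \<in> space ?M"
        then have "x \<in> freq_set b (p x)" using p space by blast
        then show "(\<lambda>n. (\<Sum>k=1..n. ln (\<Sum>j. \<gamma> (digit b k x) j powr a)) / real n) \<longlonglongrightarrow> pressure b \<gamma> (p x) a"
          unfolding pressure_def by (rule freq_set_mean[OF base])
      next
        fix n
        have "(\<lambda>x. ln (\<Sum>j. \<gamma> (digit b k x) j powr a)) \<in> borel_measurable borel" for k
          using measurable_compose[OF measurable_digit, of "\<lambda>d. ln (\<Sum>j. \<gamma> d j powr a)" borel b k] by simp
        then show "(\<lambda>x. (\<Sum>k=1..n. ln (\<Sum>j. \<gamma> (digit b k x) j powr a)) / real n) \<in> borel_measurable ?M"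
          by (intro measurable_restrict_space1) measurable
      qed
      ultimately show ?thesis by simp
    qed
  qed
  have near: "\<exists>z\<in>?Q. dist z x < e \<and> ?H z = ?H y" if x: "x \<in> ?Q" and y: "y \<in> ?Q" and e: "0 < e" for x y e
  proof -
    obtain q where q: "stochastic b q" "y \<in> freq_set b q" using y unfolding quasinormal_def by blast
    obtain z where z: "z \<in> freq_set b q" "dist z x < e" using freq_set_dense[OF base x q(2) e] .
    then show ?thesis using const[OF q(1) z(1) q(2)] in_Q[OF q(1) z(1)] by blast
  qed
  have disc: "\<not> continuous (at x within ?Q) ?H" if nd: "\<not> degenerate b \<gamma>" and x: "x \<in> ?Q" for x
  proof
    assume cont: "continuous (at x within ?Q) ?H"
    have eq: "?H y = ?H x" if y: "y \<in> ?Q" for y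
    proof (rule ccontr)
      assume "?H y \<noteq> ?H x"
      then have "0 < dist (?H y) (?H x)" by simp
      then obtain d where "0 < d" "\<And>z. z \<in> ?Q \<Longrightarrow> dist z x < d \<Longrightarrow> dist (?H z) (?H x) < dist (?H y) (?H x)"
        using cont unfolding continuous_within_eps_delta by blast
      moreover obtain z where "z \<in> ?Q" "dist z x < d" "?H z = ?H y" using near[OF x y \<open>0 < d\<close>] by blast
      ultimately show False by fastforce
    qed
    obtain p where p: "stochastic b p" "x \<in> freq_set b p" using x unfolding quasinormal_def by blast
    have "degenerate b \<gamma>"
    proof (rule degenerate_if_common_zero)
      show "?\<theta> < ?H x" by (rule H(1)[OF p])
      show "pressure b \<gamma> q (?H x) = 0" if "stochastic b q" "y \<in> freq_set b q" for q y
        using H(2)[OF that] eq[OF in_Q[OF that]] by simp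
    qed
    then show False using nd by blast
  qed
  have img: "?H ` ?Q = ?H ` (U \<inter> ?Q)" if x: "x \<in> ?Q" and U: "open U" "x \<in> U" for x U
  proof
    show "?H ` ?Q \<subseteq> ?H ` (U \<inter> ?Q)"
    proof
      fix t assume "t \<in> ?H ` ?Q"
      then obtain y where y: "y \<in> ?Q" "t = ?H y" by blast
      obtain e where e: "0 < e" "\<And>z. dist z x < e \<Longrightarrow> z \<in> U" using U unfolding open_dist by blast
      obtain z where "z \<in> ?Q" "dist z x < e" "?H z = ?H y" using near[OF x y(1) e(1)] by blast
      then show "t \<in> ?H ` (U \<inter> ?Q)" using e(2) y(2) by (metis IntI image_eqI)
    qed
  qed auto
  have "?H constant_on freq_set b p" if "stochastic b p" for p
    unfolding constant_on_def using const[OF that] by metis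
  then show ?thesis using meas disc img by blast
qed

end
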